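(* Suppose that for every $i=1,\dots,m$ and every $x_s\in\partial\mathcal{O}_i$, $$\frac{\lambda_{\max}}{\lambda_{\min}}\,\frac{\nabla\beta_i(x_s)^T(x_s-x^* )}{\|x_s-x^*\|^2}<\mu^i_{\min}.$$ Then for every $\varepsilon>0$ there exists a constant $K(\varepsilon)$ such that, for every $k>K(\varepsilon)$, the function $\varphi_k:\mathcal{F}\to[0,1]$ is a navigation function with minimum at some point $\bar x$ satisfying $\|\bar x-x^*\|<\varepsilon$. Furthermore, if $f_0(x^* )=0$ or $\nabla\beta(x^* )=0$, then $\bar x=x^*$.
   Context: Setting. $\mathcal{X}\subset\mathbb{R}^n$ is a nonempty compact convex set, and $\mathcal{O}_1,\dots,\mathcal{O}_m\subset\mathcal{X}$ (the obstacles) are open convex sets with nonempty interior and smooth boundary. $\beta_0:\mathbb{R}^n\to\mathbb{R}$ is a twice continuously differentiable concave function with $\mathcal{X}=\{x:\beta_0(x)\ge 0\}$ and $\partial\mathcal{X}=\{x:\beta_0(x)=0\}$. For $i=1,\dots,m$, $\beta_i:\mathbb{R}^n\to\mathbb{R}$ is a twice continuously differentiable convex function with $\mathcal{O}_i=\{x:\beta_i(x)<0\}$. Put $\beta(x)=\prod_{i=0}^m\beta_i(x)$. The free space is $\mathcal{F}=\{x\in\mathbb{R}^n:\beta(x)\ge 0\}=\mathcal{X}\setminus\bigcup_{i=1}^m\mathcal{O}_i$. Obstacles do not intersect: for every $x\in\mathbb{R}^n$, if $\beta_i(x)\le 0$ for some $i\in\{0,\dots,m\}$, then $\beta_j(x)>0$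 for all $j\in\{0,\dots,m\}$, $j\ne i$. Objective and curvature bounds: $f_0:\mathcal{X}\to\mathbb{R}_+$ (nonnegative values) is twice continuously differentiable and strongly convex on $\mathcal{X}$, with the eigenvalues of $\nabla^2 f_0(x)$ contained in $[\lambda_{\min},\lambda_{\max}]$, $\lambda_{\min}>0$, for all $x\in\mathcal{X}$; its minimizer $x^*=\arg\min f_0$ lies in $\mathrm{int}(\mathcal{F})$ (so $\nabla f_0(x^* )=0$ and $f_0(x^* )\ge0$). For $i=1,\dots,m$, $\beta_i$ is strongly convex on $\mathcal{X}$, with the eigenvalues of $\nabla^2\beta_i(x)$ contained in $[\mu^i_{\min},\mu^i_{\max}]$, $\mu^i_{\min}>0$, for all $x\in\mathcal{X}$. Artificial potential: for a real parameter $k>0$, $\varphi_k(x)=\dfrac{f_0(x)}{\left(f_0^k(x)+\beta(x)\right)^{1/k}}$, $x\in\mathcal{F}$. Navigation function. $\mathcal{F}$ is assumed to be a compact connected analytic manifold with boundary. A map $\varphi:\mathcal{F}\to[0,1]$ is a navigation function with minimum at $p\in\mathrm{int}(\mathcal{F})$ if: (Differentiable) $\varphi$ is twice continuously differentiable in $\mathcal{F}$; (Polar) $\varphi$ has a unique (local) minimum, located at $p$; (Morse) all critical points of $\varphi$ on $\mathcal{F}$ are nondegenerate; (Admissible) $\partial\mathcal{F}=\varphi^{-1}(1)$. *)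

theory Defs
  imports "HOL-Analysis.Analysis"
begin

text \<open>
  All derivatives are taken within a set \<open>S\<close>, so that functions living only on a closed domain
  can be treated: \<open>S = UNIV\<close> gives the usual derivatives, and on a convex set with nonempty
  interior, or a full-dimensional manifold with boundary, derivatives within \<open>S\<close> are unique at
  every point of \<open>S\<close>, boundary points included. Only the values of the function on \<open>S\<close> matter.
\<close>

definition grad_on :: "(real ^ 'n) set \<Rightarrow> (real ^ 'n \<Rightarrow> real) \<Rightarrow> real ^ 'n \<Rightarrow> real ^ 'n" where
  "grad_on S f x = (\<chi> i. frechet_derivative f (at x within S) (axis i 1))"

definition hessian_on :: "(real ^ 'n) set \<Rightarrow> (real ^ 'n \<Rightarrow> real) \<Rightarrow> real ^ 'n \<Rightarrow> real ^ 'n ^ 'n" where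
  "hessian_on S f x = matrix (frechet_derivative (grad_on S f) (at x within S))"

text \<open>\<open>Ck_on k S f\<close>: the function is \<open>k\<close> times continuously differentiable on \<open>S\<close>;
  \<open>D i\<close> is the \<open>i\<close>-th partial derivative.\<close>

primrec Ck_on :: "nat \<Rightarrow> (real ^ 'n) set \<Rightarrow> (real ^ 'n \<Rightarrow> real) \<Rightarrow> bool" where
  "Ck_on 0 S f \<longleftrightarrow> continuous_on S f"
| "Ck_on (Suc k) S f \<longleftrightarrow>
     (\<exists>D :: 'n \<Rightarrow> real ^ 'n \<Rightarrow> real.
        (\<forall>x\<in>S. (f has_derivative (\<lambda>h. \<Sum>i\<in>UNIV. D i x * h $ i)) (at x within S)) \<and>
        (\<forall>i. Ck_on k S (D i)))"

definition smooth_on :: "(real ^ 'n) set \<Rightarrow> (real ^ 'n \<Rightarrow> real) \<Rightarrow> bool" where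
  "smooth_on S f \<longleftrightarrow> (\<forall>k. Ck_on k S f)"

definition eigenvalues :: "real ^ 'n ^ 'n \<Rightarrow> real set" where
  "eigenvalues A = {e. \<exists>v. v \<noteq> 0 \<and> A *v v = e *\<^sub>R v}"

definition strongly_convex_on :: "(real ^ 'n) set \<Rightarrow> (real ^ 'n \<Rightarrow> real) \<Rightarrow> bool" where
  "strongly_convex_on S f \<longleftrightarrow> (\<exists>c>0. convex_on S (\<lambda>x. f x - c / 2 * (norm x)\<^sup>2))"

text \<open>An open set has smooth boundary if near each boundary point it is a strict sublevel set of a
  smooth function without critical points.\<close>

definition has_smooth_boundary :: "(real ^ 'n) set \<Rightarrow> bool" where
  "has_smooth_boundary S \<longleftrightarrow>
     (\<forall>p\<in>frontier S. \<exists>U g. open U \<and> p \<in> U \<and> smooth_on U g \<and>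
        (\<forall>x\<in>U. grad_on U g x \<noteq> 0) \<and> S \<inter> U = {x \<in> U. g x < 0})"

text \<open>Real analyticity: local expansion in an (absolutely) convergent power series indexed by
  multi-indices \<open>a :: 'n \<Rightarrow> nat\<close>.\<close>

definition real_analytic_on :: "(real ^ 'n) set \<Rightarrow> (real ^ 'n \<Rightarrow> real) \<Rightarrow> bool" where
  "real_analytic_on U f \<longleftrightarrow>
     (\<forall>x\<in>U. \<exists>r>0. \<exists>c :: ('n \<Rightarrow> nat) \<Rightarrow> real. ball x r \<subseteq> U \<and>
        (\<forall>y\<in>ball x r.
           ((\<lambda>a. c a * (\<Prod>i\<in>UNIV. (y $ i - x $ i) ^ a i)) has_sum f y) UNIV))"

text \<open>Full-dimensional analytic submanifolds with boundary of the ambient space: every point has an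
  ambient analytic chart that flattens the set onto a relatively open piece of a closed half-space.
  Interior points are covered by charts whose image \<open>V\<close> avoids the bounding hyperplane.\<close>

definition analytic_manifold_with_boundary :: "(real ^ 'n) set \<Rightarrow> bool" where
  "analytic_manifold_with_boundary M \<longleftrightarrow>
     (\<forall>p\<in>M. \<exists>U V g h. \<exists>j :: 'n. open U \<and> p \<in> U \<and> open V \<and> homeomorphism U V g h \<and>
        (\<forall>i. real_analytic_on U (\<lambda>x. g x $ i)) \<and> (\<forall>i. real_analytic_on V (\<lambda>y. h y $ i)) \<and>
        g ` (M \<inter> U) = {y \<in> V. 0 \<le> y $ j})"

definition local_min_on :: "(real ^ 'n) set \<Rightarrow> (real ^ 'n \<Rightarrow> real) \<Rightarrow> real ^ 'n \<Rightarrow> bool" where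
  "local_min_on S f p \<longleftrightarrow> p \<in> S \<and> (\<exists>r>0. \<forall>y \<in> S \<inter> ball p r. f p \<le> f y)"

definition navigation_function ::
  "(real ^ 'n) set \<Rightarrow> (real ^ 'n \<Rightarrow> real) \<Rightarrow> real ^ 'n \<Rightarrow> bool" where
  "navigation_function F \<phi> p \<longleftrightarrow>
     \<phi> ` F \<subseteq> {0..1} \<and>
     p \<in> interior F \<and>
     Ck_on 2 F \<phi> \<and>
     (\<forall>x. local_min_on F \<phi> x \<longleftrightarrow> x = p) \<and>
     (\<forall>x\<in>F. grad_on F \<phi> x = 0 \<longrightarrow> invertible (hessian_on F \<phi> x)) \<and>
     frontier F = {x \<in> F. \<phi> x = 1}"

definition beta_prod :: "nat \<Rightarrow> (nat \<Rightarrow> real ^ 'n \<Rightarrow> real) \<Rightarrow> real ^ 'n \<Rightarrow> real" where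
  "beta_prod m \<beta> x = (\<Prod>i\<le>m. \<beta> i x)"

definition free_space :: "nat \<Rightarrow> (nat \<Rightarrow> real ^ 'n \<Rightarrow> real) \<Rightarrow> (real ^ 'n) set" where
  "free_space m \<beta> = {x. 0 \<le> beta_prod m \<beta> x}"

definition potential ::
  "(real ^ 'n \<Rightarrow> real) \<Rightarrow> nat \<Rightarrow> (nat \<Rightarrow> real ^ 'n \<Rightarrow> real) \<Rightarrow> real \<Rightarrow> real ^ 'n \<Rightarrow> real" where
  "potential f m \<beta> k x = f x / (f x powr k + beta_prod m \<beta> x) powr (1 / k)"

text \<open>The second description of the free space follows from the separation hypothesis on the
  functions \<open>\<beta> i\<close>, so it need not be assumed.\<close>

lemma free_space_eq:
  assumes sep: "\<And>x i j. \<lbrakk>i \<le> m; \<beta> i x \<le> 0; j \<le> m; j \<noteq> i\<rbrakk> \<Longrightarrow> \<beta> j x > 0"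
    and X: "X = {x. 0 \<le> \<beta> 0 x}"
    and Obs: "\<And>i. i \<in> {1..m} \<Longrightarrow> Obs i = {x. \<beta> i x < 0}"
  shows "free_space m \<beta> = X - (\<Union>i\<in>{1..m}. Obs i)"
proof -
  have key: "0 \<le> beta_prod m \<beta> x \<longleftrightarrow> (\<forall>i\<le>m. 0 \<le> \<beta> i x)" for x
  proof
    assume pos: "0 \<le> beta_prod m \<beta> x"
    show "\<forall>i\<le>m. 0 \<le> \<beta> i x"
    proof (rule ccontr)
      assume "\<not> (\<forall>i\<le>m. 0 \<le> \<beta> i x)"
      then obtain i where i: "i \<le> m" "\<beta> i x < 0" by (auto simp: not_le)
      have "(\<Prod>j\<in>{..m} - {i}. \<beta> j x) > 0"
        using i sep[of i x] by (intro prod_pos) auto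
      moreover have "beta_prod m \<beta> x = \<beta> i x * (\<Prod>j\<in>{..m} - {i}. \<beta> j x)"
        unfolding beta_prod_def using i by (intro prod.remove) auto
      ultimately show False using i pos by (simp add: zero_le_mult_iff)
    qed
  qed (auto simp: beta_prod_def intro!: prod_nonneg)
  have "(\<forall>i\<le>m. 0 \<le> \<beta> i x) \<longleftrightarrow> 0 \<le> \<beta> 0 x \<and> (\<forall>i\<in>{1..m}. \<not> \<beta> i x < 0)" for x
    by (metis One_nat_def atLeastAtMost_iff le0 not_less not_less_eq_eq le_zero_eq)
  then show ?thesis
    using Obs by (auto simp: free_space_def key X)
qed

end

theory Submission
  imports Defs
begin

text \<open>
  Write \<open>B\<close> for the product of the \<open>\<beta> i\<close>. The gradient of \<open>\<phi>\<^sub>k\<close> is a positive multiple of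
  \<open>N = B \<nabla>f - (f / k) \<nabla>B\<close>, so at an interior critical point \<open>k B \<nabla>f = f \<nabla>B\<close> and the Hessian is a positive
  multiple of the derivative of \<open>N\<close>. Away from \<open>x\<^sup>*\<close> this forces \<open>B = O(1 / k)\<close>; pairing with
  \<open>x - x\<^sup>*\<close> rules out the outer boundary, and near an obstacle the curvature condition makes the
  Hessian negative on the complement of \<open>\<nabla>f\<close>, while it is positive along \<open>\<nabla>f\<close> once \<open>k\<close> is large. Hence such
  critical points are nondegenerate and are not local minima. Near \<open>x\<^sup>*\<close> the field \<open>N\<close> is strongly
  monotone, so it has at most one zero there, and the global minimizer of \<open>\<phi>\<^sub>k\<close> must be that zero.
  In dimension one there is no direction orthogonal to \<open>\<nabla>f\<close>; connectedness of the free space then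
  excludes critical points away from \<open>x\<^sup>*\<close>.
\<close>

subsection \<open>Second derivatives and quadratic forms\<close>

text \<open>The ratio \<open>L / l\<close> in the curvature condition arises at a critical point
  \<open>x\<close>, where \<open>GB x = s *\<^sub>R Gf x\<close> with
  \<open>s = k * B x / f x\<close>. For a unit \<open>v\<close> orthogonal to \<open>Gf x\<close>
  the mixed terms of the Hessian vanish, leaving \<open>B x\<close> times the form of
  \<open>Hf x\<close> minus \<open>f x / k\<close> times the form of \<open>HB x\<close>; as
  \<open>f x / k * s = B x\<close>, this is negative once \<open>s * L\<close> is below the form of
  \<open>HB x\<close>. Strong convexity of \<open>f\<close> gives
  \<open>s * l * (norm (x - p))\<^sup>2 \<le> GB x \<bullet> (x - p)\<close>, and multiplying by
  \<open>L / l\<close> yields the very quantity that the condition bounds. The condition is known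
  only where \<open>B x = 0\<close>; compactness carries it to a layer where \<open>B\<close> is
  small, and for large \<open>k\<close> that layer contains the critical points away from
  \<open>p\<close>. Two difficulties shape the rest. \<open>F\<close> need not be convex, so the
  mean value arguments run in a small ball or in \<open>X\<close>. And derivatives at the boundary
  are derivatives within \<open>F\<close>, so the arguments there test a single inward
  direction.\<close>

lemma has_real_derivative_along_line:
  fixes f :: "'a::real_inner \<Rightarrow> real"
  assumes "(f has_derivative (\<lambda>h. g \<bullet> h)) (at (p + s *\<^sub>R w))"
  shows "((\<lambda>s. f (p + s *\<^sub>R w)) has_real_derivative g \<bullet> w) (at s)"
proof -
  have "((\<lambda>s. p + s *\<^sub>R w) has_derivative (\<lambda>h. h *\<^sub>R w)) (at s)"
    by (auto intro!: derivative_eq_intros)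
  from has_derivative_compose[OF this assms]
  show ?thesis by (simp add: has_field_derivative_def mult_commute_abs)
qed

text \<open>The second difference is the increment, in direction \<open>u\<close>, of the first
  difference in direction \<open>v\<close>. The mean value theorem turns it into one difference of
  gradients, and both gradients are linearized at the same base point \<open>x\<close>, so
  differentiability of \<open>G\<close> at \<open>x\<close> controls the error.\<close>

lemma mixed_second_difference:
  fixes f :: "'a::real_inner \<Rightarrow> real" and G H :: "'a \<Rightarrow> 'a"
  assumes U: "open U" "x \<in> U"
    and f: "\<And>y. y \<in> U \<Longrightarrow> (f has_derivative (\<lambda>h. G y \<bullet> h)) (at y)"
    and G: "(G has_derivative H) (at x)" and e: "0 < e"
  shows "\<exists>d>0. \<forall>t. 0 < t \<and> t < d \<longrightarrow>
    \<bar>f (x + t *\<^sub>R u + t *\<^sub>R v) - f (x + t *\<^sub>R u) - f (x + t *\<^sub>R v) + f x - t\<^sup>2 * (u \<bullet> H v)\<bar> \<le> e * t\<^sup>2"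
proof -
  define C where "C = norm u + norm v + 1"
  have C: "C > 0" "norm u \<le> C" "norm u + norm v < C"
    by (auto simp: C_def add_nonneg_pos)
  \<comment> \<open>Two gradient remainders of size \<open>e' * (t * C)\<close>, each paired with a
    vector of norm at most \<open>t * C\<close>, must add up to
    \<open>e * t\<^sup>2\<close>.\<close>
  define e' where "e' = e / (2 * C\<^sup>2)"
  have e': "e' > 0" using e C by (simp add: e'_def)
  obtain d1 where d1: "d1 > 0"
    "\<And>y. norm (y - x) < d1 \<Longrightarrow> norm (G y - G x - H (y - x)) \<le> e' * norm (y - x)"
    using G e' unfolding has_derivative_at_alt by blast
  obtain r where r: "r > 0" "ball x r \<subseteq> U" using U openE by blast
  define d where "d = min d1 r / C"
  have lin: "linear H" using G has_derivative_linear by blast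
  show ?thesis
  proof (intro exI[of _ d] conjI allI impI)
    show "d > 0" using d1 r C by (simp add: d_def)
    fix t assume t: "0 < t \<and> t < d"
    then have tC: "t * C < d1" "t * C < r" using C by (auto simp: d_def pos_less_divide_eq)
    have near: "norm ((s * t) *\<^sub>R u + c *\<^sub>R v) < t * C" if "0 \<le> s" "s \<le> 1" "0 \<le> c" "c \<le> t" for s c
    proof -
      have "norm ((s * t) *\<^sub>R u + c *\<^sub>R v) \<le> (s * t) * norm u + c * norm v"
        using norm_triangle_ineq[of "(s * t) *\<^sub>R u" "c *\<^sub>R v"] that t by simp
      also have "\<dots> \<le> t * norm u + t * norm v"
        using that t by (intro add_mono mult_right_mono) (auto simp: mult_le_cancel_right1)
      also have "\<dots> < t * C" using t C by (simp add: distrib_left[symmetric])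
      finally show ?thesis .
    qed
    define R where "R y = G y - G x - H (y - x)" for y
    have Rb: "norm (R (x + (s * t) *\<^sub>R u + c *\<^sub>R v)) \<le> e' * (t * C)"
      if "0 \<le> s" "s \<le> 1" "0 \<le> c" "c \<le> t" for s c
    proof -
      have "norm (R (x + (s * t) *\<^sub>R u + c *\<^sub>R v)) \<le> e' * norm ((s * t) *\<^sub>R u + c *\<^sub>R v)"
        using d1(2)[of "x + (s * t) *\<^sub>R u + c *\<^sub>R v"] near[OF that] tC
        by (simp add: R_def add.assoc)
      also have "\<dots> \<le> e' * (t * C)" using near[OF that] e' by simp
      finally show ?thesis .
    qed
    have inU: "x + (s * t) *\<^sub>R u + c *\<^sub>R v \<in> U" if "0 \<le> s" "s \<le> 1" "0 \<le> c" "c \<le> t" for s c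
      using near[OF that] tC r by (auto simp: dist_norm subset_iff add.assoc norm_minus_commute)
    define g where "g s = f ((x + t *\<^sub>R v) + s *\<^sub>R (t *\<^sub>R u)) - f (x + s *\<^sub>R (t *\<^sub>R u))" for s
    define g' where "g' s = (G ((x + t *\<^sub>R v) + s *\<^sub>R (t *\<^sub>R u)) - G (x + s *\<^sub>R (t *\<^sub>R u))) \<bullet> (t *\<^sub>R u)" for s
    have "(g has_real_derivative g' s) (at s)" if "0 \<le> s" "s \<le> 1" for s
      unfolding g_def g'_def inner_diff_left
      using inU[of s t] inU[of s 0] that t
      by (intro DERIV_diff has_real_derivative_along_line f) (auto simp: algebra_simps)
    from MVT2[of 0 1 g g', OF _ this] obtain s where s: "0 < s" "s < 1" "g 1 - g 0 = g' s" by auto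
    let ?R1 = "R (x + (s * t) *\<^sub>R u + t *\<^sub>R v)" and ?R2 = "R (x + (s * t) *\<^sub>R u + 0 *\<^sub>R v)"
    have Gd: "G ((x + t *\<^sub>R v) + s *\<^sub>R (t *\<^sub>R u)) - G (x + s *\<^sub>R (t *\<^sub>R u)) = t *\<^sub>R H v + (?R1 - ?R2)"
      by (simp add: R_def linear_add[OF lin] linear_scale[OF lin] algebra_simps)
    have "\<bar>(?R1 - ?R2) \<bullet> (t *\<^sub>R u)\<bar> \<le> norm (?R1 - ?R2) * norm (t *\<^sub>R u)"
      by (rule Cauchy_Schwarz_ineq2)
    also have "\<dots> \<le> (e' * (t * C) + e' * (t * C)) * (t * C)"
    proof (rule mult_mono)
      show "norm (?R1 - ?R2) \<le> e' * (t * C) + e' * (t * C)"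
        using Rb[of s t] Rb[of s 0] s t norm_triangle_ineq4[of ?R1 ?R2] by linarith
    qed (use t C e' in auto)
    also have "\<dots> = e * t\<^sup>2" using C by (simp add: e'_def power2_eq_square field_simps)
    finally have "\<bar>g 1 - g 0 - t\<^sup>2 * (u \<bullet> H v)\<bar> \<le> e * t\<^sup>2"
      using s(3) unfolding g'_def Gd
      by (simp add: inner_add_left power2_eq_square inner_commute algebra_simps)
    moreover have "g 1 - g 0 = f (x + t *\<^sub>R u + t *\<^sub>R v) - f (x + t *\<^sub>R u) - f (x + t *\<^sub>R v) + f x"
      by (simp add: g_def algebra_simps)
    ultimately show "\<bar>f (x + t *\<^sub>R u + t *\<^sub>R v) - f (x + t *\<^sub>R u) - f (x + t *\<^sub>R v) + f x
        - t\<^sup>2 * (u \<bullet> H v)\<bar> \<le> e * t\<^sup>2" by simp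
  qed
qed

text \<open>The mixed second difference does not change when \<open>u\<close> and \<open>v\<close>
  are exchanged, while \<open>t\<^sup>2 * (u \<bullet> H v)\<close> and
  \<open>t\<^sup>2 * (v \<bullet> H u)\<close> both approximate it up to an arbitrarily small
  multiple of \<open>t\<^sup>2\<close>.\<close>

lemma second_derivative_symmetric:
  fixes f :: "'a::real_inner \<Rightarrow> real" and G H :: "'a \<Rightarrow> 'a"
  assumes "open U" "x \<in> U"
    and "\<And>y. y \<in> U \<Longrightarrow> (f has_derivative (\<lambda>h. G y \<bullet> h)) (at y)"
    and "(G has_derivative H) (at x)"
  shows "u \<bullet> H v = v \<bullet> H u"
proof (rule ccontr)
  assume "u \<bullet> H v \<noteq> v \<bullet> H u"
  define e where "e = \<bar>u \<bullet> H v - v \<bullet> H u\<bar> / 3"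
  have e: "e > 0" using \<open>u \<bullet> H v \<noteq> v \<bullet> H u\<close> by (simp add: e_def)
  let ?D = "\<lambda>t u v. f (x + t *\<^sub>R u + t *\<^sub>R v) - f (x + t *\<^sub>R u) - f (x + t *\<^sub>R v) + f x"
  obtain d1 where d1: "d1 > 0"
    "\<And>t. 0 < t \<Longrightarrow> t < d1 \<Longrightarrow> \<bar>?D t u v - t\<^sup>2 * (u \<bullet> H v)\<bar> \<le> e * t\<^sup>2"
    using mixed_second_difference[OF assms e, of u v] by auto
  obtain d2 where d2: "d2 > 0"
    "\<And>t. 0 < t \<Longrightarrow> t < d2 \<Longrightarrow> \<bar>?D t v u - t\<^sup>2 * (v \<bullet> H u)\<bar> \<le> e * t\<^sup>2"
    using mixed_second_difference[OF assms e, of v u] by auto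
  define t where "t = min d1 d2 / 2"
  have t: "0 < t" "t < d1" "t < d2" using d1 d2 by (auto simp: t_def)
  have "?D t u v = ?D t v u" by (simp add: algebra_simps)
  then have "\<bar>t\<^sup>2 * (u \<bullet> H v) - t\<^sup>2 * (v \<bullet> H u)\<bar> \<le> e * t\<^sup>2 + e * t\<^sup>2"
    using d1(2)[OF t(1,2)] d2(2)[OF t(1,3)] by linarith
  moreover have "\<bar>t\<^sup>2 * (u \<bullet> H v) - t\<^sup>2 * (v \<bullet> H u)\<bar> = t\<^sup>2 * \<bar>u \<bullet> H v - v \<bullet> H u\<bar>"
    unfolding right_diff_distrib[symmetric] by (simp add: abs_mult)
  ultimately have "t\<^sup>2 * \<bar>u \<bullet> H v - v \<bullet> H u\<bar> \<le> t\<^sup>2 * (2 * e)"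
    by (simp add: mult.commute)
  then have "\<bar>u \<bullet> H v - v \<bullet> H u\<bar> \<le> 2 * e"
    by (rule mult_left_le_imp_le) (use t in auto)
  then show False using e by (simp add: e_def)
qed

text \<open>The minimum \<open>m\<close> of the quadratic form on the unit sphere is itself an
  eigenvalue, so \<open>a \<le> m\<close>; homogeneity extends the bound to all vectors.\<close>

lemma inner_matrix_ge_if_eigenvalues_ge:
  fixes A :: "real ^ 'n ^ 'n"
  assumes sym: "\<And>u v. u \<bullet> (A *v v) = v \<bullet> (A *v u)"
    and ev: "\<And>e. e \<in> eigenvalues A \<Longrightarrow> a \<le> e"
  shows "a * (norm v)\<^sup>2 \<le> v \<bullet> (A *v v)"
proof -
  let ?S = "sphere (0 :: real^'n) 1"
  have "axis undefined 1 \<in> ?S" by (simp add: norm_axis_1)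
  then have ne: "?S \<noteq> {}" by blast
  have cont: "continuous_on ?S (\<lambda>w. w \<bullet> (A *v w))"
    by (rule continuous_on_inner[OF continuous_on_id matrix_vector_mult_linear_continuous_on])
  from continuous_attains_inf[OF compact_sphere ne cont]
  obtain u where u: "u \<in> ?S" "\<And>w. w \<in> ?S \<Longrightarrow> u \<bullet> (A *v u) \<le> w \<bullet> (A *v w)"
    by metis
  define m where "m = u \<bullet> (A *v u)"
  have ge: "m * (norm w)\<^sup>2 \<le> w \<bullet> (A *v w)" for w
  proof (cases "w = 0")
    case False
    have "m \<le> ((1 / norm w) *\<^sub>R w) \<bullet> (A *v ((1 / norm w) *\<^sub>R w))"
      unfolding m_def using False by (intro u) simp
    also have "\<dots> = (w \<bullet> (A *v w)) / (norm w)\<^sup>2"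
      by (simp add: matrix_vector_mult_scaleR power2_eq_square)
    finally show ?thesis using False by (simp add: pos_le_divide_eq)
  qed simp
  define B where "B w = A *v w - m *\<^sub>R w" for w
  \<comment> \<open>\<open>B\<close> is the map \<open>A - m I\<close>, whose form is nonnegative
    and vanishes at the minimizer \<open>u\<close>. Moving from \<open>u\<close> along
    \<open>h\<close> gives a quadratic in \<open>t\<close> that is nonnegative and zero at
    \<open>t = 0\<close>, hence has no linear term.\<close>
  have "h \<bullet> B u = 0" for h
  proof (rule ccontr)
    assume ne: "h \<bullet> B u \<noteq> 0"
    have Bnn: "0 \<le> w \<bullet> B w" for w
      using ge[of w] by (simp add: B_def inner_diff_right dot_square_norm)
    have uBu: "u \<bullet> B u = 0" using u(1) by (simp add: B_def inner_diff_right m_def dot_square_norm)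
    have symB: "u \<bullet> B h = h \<bullet> B u"
      using sym[of u h] by (simp add: B_def inner_diff_right inner_commute)
    have B_lin: "B (u + t *\<^sub>R h) = B u + t *\<^sub>R B h" for t
      by (simp add: B_def matrix_vector_right_distrib matrix_vector_mult_scaleR algebra_simps)
    have q: "0 \<le> 2 * t * (h \<bullet> B u) + t\<^sup>2 * (h \<bullet> B h)" for t
    proof -
      have "(u + t *\<^sub>R h) \<bullet> B (u + t *\<^sub>R h) = 2 * t * (h \<bullet> B u) + t\<^sup>2 * (h \<bullet> B h)"
        unfolding B_lin using uBu symB by (simp add: inner_add_left inner_add_right power2_eq_square algebra_simps)
      then show ?thesis using Bnn[of "u + t *\<^sub>R h"] by simp
    qed
    define c where "c = h \<bullet> B u"
    define b where "b = h \<bullet> B h"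
    have "0 \<le> b" using Bnn by (simp add: b_def)
    \<comment> \<open>The quadratic \<open>2 * t * c + t\<^sup>2 * b\<close> is smallest at
      \<open>- c / b\<close>; adding one to the denominator covers \<open>b = 0\<close> and still
      keeps \<open>r * b < 2\<close>.\<close>
    define r where "r = 1 / (b + 1)"
    have r: "0 < r" "r * b = 1 - r" using \<open>0 \<le> b\<close> by (auto simp: r_def field_simps)
    have "2 * (- c * r) * c + (- c * r)\<^sup>2 * b = c\<^sup>2 * r * (r * b - 2)"
      by (simp add: power2_eq_square algebra_simps)
    also have "\<dots> < 0"
      using ne r unfolding c_def[symmetric] by (intro mult_pos_neg) auto
    finally show False using q[of "- c * r"] by (simp add: b_def c_def)
  qed
  from this[of "B u"] have "A *v u = m *\<^sub>R u" by (simp add: B_def)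
  moreover have "u \<noteq> 0" using u(1) by auto
  ultimately have "a \<le> m" using ev unfolding eigenvalues_def by blast
  then have "a * (norm v)\<^sup>2 \<le> m * (norm v)\<^sup>2" by (rule mult_right_mono) simp
  then show ?thesis using ge[of v] by linarith
qed

lemma inner_matrix_le_if_eigenvalues_le:
  fixes A :: "real ^ 'n ^ 'n"
  assumes sym: "\<And>u v. u \<bullet> (A *v v) = v \<bullet> (A *v u)"
    and ev: "\<And>e. e \<in> eigenvalues A \<Longrightarrow> e \<le> b"
  shows "v \<bullet> (A *v v) \<le> b * (norm v)\<^sup>2"
proof -
  have neg: "(- A) *v w = - (A *v w)" for w
    using matrix_vector_mult_diff_rdistrib[of 0 A w] by simp
  have "- b \<le> e" if "e \<in> eigenvalues (- A)" for e
  proof -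
    from that obtain w where "w \<noteq> 0" "- (A *v w) = e *\<^sub>R w" by (auto simp: eigenvalues_def neg)
    then have "w \<noteq> 0 \<and> A *v w = (- e) *\<^sub>R w" by (metis minus_minus scaleR_minus_left)
    then have "- e \<in> eigenvalues A" unfolding eigenvalues_def by blast
    then show ?thesis using ev by force
  qed
  from inner_matrix_ge_if_eigenvalues_ge[of "- A" "- b" v, OF _ this] show ?thesis
    using sym by (simp add: neg)
qed

subsection \<open>Continuously differentiable functions\<close>

lemma Ck_on_Suc_imp: "Ck_on (Suc k) S f \<Longrightarrow> Ck_on k S f"
proof (induction k arbitrary: f)
  case 0
  then show ?case
    by (auto simp: continuous_on_eq_continuous_within dest: has_derivative_continuous)
next
  case (Suc k)
  obtain D where
    D: "\<forall>x\<in>S. (f has_derivative (\<lambda>h. \<Sum>i\<in>UNIV. D i x * h $ i)) (at x within S)"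
       "\<forall>i. Ck_on (Suc k) S (D i)"
    using Suc.prems unfolding Ck_on.simps(2)[of "Suc k"] by blast
  then have "\<forall>i. Ck_on k S (D i)" using Suc.IH by blast
  with D(1) show ?case unfolding Ck_on.simps(2)[of k] by blast
qed

lemma Ck_on_subset: "Ck_on k S f \<Longrightarrow> T \<subseteq> S \<Longrightarrow> Ck_on k T f"
proof (induction k arbitrary: f)
  case (Suc k)
  obtain D where
    D: "\<forall>x\<in>S. (f has_derivative (\<lambda>h. \<Sum>i\<in>UNIV. D i x * h $ i)) (at x within S)" "\<forall>i. Ck_on k S (D i)"
    using Suc.prems(1) by auto
  have "\<forall>x\<in>T. (f has_derivative (\<lambda>h. \<Sum>i\<in>UNIV. D i x * h $ i)) (at x within T)"
    using D(1) Suc.prems(2) has_derivative_subset by blast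
  moreover have "\<forall>i. Ck_on k T (D i)" using D(2) Suc by blast
  ultimately show ?case unfolding Ck_on.simps by blast
qed (auto intro: continuous_on_subset)

lemma Ck_on_const: "Ck_on k S (\<lambda>x. c)"
proof (induction k arbitrary: c)
  case (Suc k)
  show ?case by (auto intro!: exI[of _ "\<lambda>i x. 0"] Suc simp: has_derivative_const)
qed simp

lemma Ck_on_add: "Ck_on k S f \<Longrightarrow> Ck_on k S g \<Longrightarrow> Ck_on k S (\<lambda>x. f x + g x)"
proof (induction k arbitrary: f g)
  case (Suc k)
  obtain D where
    D: "\<forall>x\<in>S. (f has_derivative (\<lambda>h. \<Sum>i\<in>UNIV. D i x * h $ i)) (at x within S)" "\<forall>i. Ck_on k S (D i)"
    using Suc.prems(1) by auto
  obtain E where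
    E: "\<forall>x\<in>S. (g has_derivative (\<lambda>h. \<Sum>i\<in>UNIV. E i x * h $ i)) (at x within S)" "\<forall>i. Ck_on k S (E i)"
    using Suc.prems(2) by auto
  have "((\<lambda>x. f x + g x) has_derivative (\<lambda>h. \<Sum>i\<in>UNIV. (D i x + E i x) * h $ i)) (at x within S)"
    if "x \<in> S" for x
    using has_derivative_add[OF D(1)[rule_format, OF that] E(1)[rule_format, OF that]]
    by (simp add: distrib_right sum.distrib)
  with Suc.IH[OF D(2)[rule_format] E(2)[rule_format]] show ?case
    unfolding Ck_on.simps by (intro exI[of _ "\<lambda>i x. D i x + E i x"]) blast
qed (auto intro: continuous_intros)

lemma Ck_on_mult: "Ck_on k S f \<Longrightarrow> Ck_on k S g \<Longrightarrow> Ck_on k S (\<lambda>x. f x * g x)"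
proof (induction k arbitrary: f g)
  case (Suc k)
  obtain D where
    D: "\<forall>x\<in>S. (f has_derivative (\<lambda>h. \<Sum>i\<in>UNIV. D i x * h $ i)) (at x within S)" "\<forall>i. Ck_on k S (D i)"
    using Suc.prems(1) by auto
  obtain E where
    E: "\<forall>x\<in>S. (g has_derivative (\<lambda>h. \<Sum>i\<in>UNIV. E i x * h $ i)) (at x within S)" "\<forall>i. Ck_on k S (E i)"
    using Suc.prems(2) by auto
  have "((\<lambda>x. f x * g x) has_derivative (\<lambda>h. \<Sum>i\<in>UNIV. (f x * E i x + D i x * g x) * h $ i)) (at x within S)"
    if "x \<in> S" for x
    using has_derivative_mult[OF D(1)[rule_format, OF that] E(1)[rule_format, OF that]]
    by (simp add: algebra_simps sum.distrib sum_distrib_left)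
  moreover have "Ck_on k S (\<lambda>x. f x * E i x + D i x * g x)" for i
    using Suc D(2)[rule_format] E(2)[rule_format] Ck_on_Suc_imp by (intro Ck_on_add Suc.IH) blast+
  ultimately show ?case
    unfolding Ck_on.simps by (intro exI[of _ "\<lambda>i x. f x * E i x + D i x * g x"]) blast
qed (auto intro: continuous_intros)

lemma Ck_on_prod: "(\<And>i. i \<in> I \<Longrightarrow> Ck_on k S (f i)) \<Longrightarrow> Ck_on k S (\<lambda>x. \<Prod>i\<in>I. f i x)"
  by (induction I rule: infinite_finite_induct) (auto intro: Ck_on_const Ck_on_mult)

text \<open>The outer function is given together with its successive derivatives \<open>h j\<close>, taken within a set
  \<open>T\<close> that may contain boundary points.\<close>

lemma Ck_on_compose:
  fixes h :: "nat \<Rightarrow> real \<Rightarrow> real"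
  assumes "Ck_on k S f" "\<And>x. x \<in> S \<Longrightarrow> f x \<in> T"
    and "\<And>j t. j < k \<Longrightarrow> t \<in> T \<Longrightarrow> (h j has_real_derivative h (Suc j) t) (at t within T)"
    and "continuous_on T (h k)"
  shows "Ck_on k S (\<lambda>x. h 0 (f x))"
  using assms
proof (induction k arbitrary: f h)
  case 0
  then show ?case using continuous_on_compose2[of T "h 0" S f] by auto
next
  case (Suc k)
  obtain D where
    D: "\<forall>x\<in>S. (f has_derivative (\<lambda>h. \<Sum>i\<in>UNIV. D i x * h $ i)) (at x within S)" "\<forall>i. Ck_on k S (D i)"
    using Suc.prems(1) by auto
  have "((\<lambda>x. h 0 (f x)) has_derivative (\<lambda>y. \<Sum>i\<in>UNIV. (h 1 (f x) * D i x) * y $ i)) (at x within S)"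
    if "x \<in> S" for x
  proof -
    have "(h 0 has_derivative (*) (h 1 (f x))) (at (f x) within T)"
      using Suc.prems(3)[of 0 "f x"] Suc.prems(2)[OF that] by (simp add: has_field_derivative_def)
    from has_derivative_in_compose2[OF _ _ that D(1)[rule_format, OF that], of T "h 0" "\<lambda>t. (*) (h 1 t)"]
    have "((\<lambda>x. h 0 (f x)) has_derivative (\<lambda>y. h 1 (f x) * (\<Sum>i\<in>UNIV. D i x * y $ i))) (at x within S)"
      using Suc.prems(2) Suc.prems(3)[of 0] by (auto simp: has_field_derivative_def)
    then show ?thesis by (simp add: sum_distrib_left mult.assoc)
  qed
  moreover have "Ck_on k S (\<lambda>x. h 1 (f x))"
    using Suc.IH[OF Ck_on_Suc_imp[OF Suc.prems(1)] Suc.prems(2), of "\<lambda>j. h (Suc j)"] Suc.prems by auto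
  then have "Ck_on k S (\<lambda>x. h 1 (f x) * D i x)" for i
    using D(2)[rule_format] by (rule Ck_on_mult)
  ultimately show ?case
    unfolding Ck_on.simps by (intro exI[of _ "\<lambda>i x. h 1 (f x) * D i x"]) blast
qed

text \<open>At \<open>t = 0\<close> the library rule does not apply; there the difference quotient is \<open>t powr (p - 1)\<close>.\<close>

lemma has_real_derivative_powr_nonneg:
  fixes p t :: real
  assumes "0 \<le> t" "1 < p"
  shows "((\<lambda>t. t powr p) has_real_derivative p * t powr (p - 1)) (at t within {0..})"
proof (cases "t = 0")
  case False
  then have "0 < t" using assms by simp
  then show ?thesis by (rule has_field_derivative_at_within[OF has_real_derivative_powr])
next
  case True
  have "continuous_on {0..} (\<lambda>t::real. t powr (p - 1))"
    by (rule continuous_on_powr'[OF continuous_on_id continuous_on_const]) (use assms in auto)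
  then have "continuous (at 0 within {0..}) (\<lambda>t::real. t powr (p - 1))"
    by (simp add: continuous_on_eq_continuous_within)
  then have "((\<lambda>y::real. y powr (p - 1)) \<longlongrightarrow> 0) (at 0 within {0..})"
    by (simp add: continuous_within)
  moreover have "eventually (\<lambda>y. y powr (p - 1) = (y powr p - 0 powr p) / (y - 0)) (at 0 within {0::real..})"
    by (auto simp: eventually_at powr_diff intro!: exI[of _ 1])
  ultimately have "((\<lambda>y::real. (y powr p - 0 powr p) / (y - 0)) \<longlongrightarrow> 0) (at 0 within {0..})"
    by (rule Lim_transform_eventually)
  then show ?thesis using True by (simp add: has_field_derivative_iff)
qed

text \<open>\<open>grad_on\<close> and \<open>hessian_on\<close> select a derivative by choice,
  which identifies it only where it is unique. With explicit fields \<open>G\<close> and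
  \<open>H\<close> the product and chain rules apply at boundary points as well; the identification
  with \<open>grad_on\<close> and \<open>hessian_on\<close> is made on the interior.\<close>

definition gradient_hessian_on ::
  "(real^'n) set \<Rightarrow> (real^'n \<Rightarrow> real) \<Rightarrow> (real^'n \<Rightarrow> real^'n) \<Rightarrow> (real^'n \<Rightarrow> real^'n^'n) \<Rightarrow> bool" where
  "gradient_hessian_on S f G H \<longleftrightarrow>
     (\<forall>x\<in>S. (f has_derivative (\<lambda>h. G x \<bullet> h)) (at x within S)) \<and>
     (\<forall>x\<in>S. (G has_derivative (\<lambda>h. H x *v h)) (at x within S)) \<and>
     continuous_on S H"

lemma
  assumes "gradient_hessian_on S f G H"
  shows gradient_hessian_onD1: "x \<in> S \<Longrightarrow> (f has_derivative (\<lambda>h. G x \<bullet> h)) (at x within S)"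
    and gradient_hessian_onD2: "x \<in> S \<Longrightarrow> (G has_derivative (\<lambda>h. H x *v h)) (at x within S)"
    and gradient_hessian_onD3: "continuous_on S H"
    and gradient_hessian_on_continuous: "continuous_on S f" "continuous_on S G"
  using assms unfolding gradient_hessian_on_def continuous_on_eq_continuous_within
  by (auto dest: has_derivative_continuous)

lemma gradient_hessian_on_subset:
  "gradient_hessian_on S f G H \<Longrightarrow> T \<subseteq> S \<Longrightarrow> gradient_hessian_on T f G H"
  unfolding gradient_hessian_on_def
  by (auto intro: continuous_on_subset has_derivative_subset)

lemma has_derivative_vec_lambda:
  fixes D :: "'i::finite \<Rightarrow> 'a::real_normed_vector \<Rightarrow> real"
  assumes "\<And>i. (D i has_derivative D' i) (at x within S)"
  shows "((\<lambda>x. \<chi> i. D i x) has_derivative (\<lambda>h. \<chi> i. D' i h)) (at x within S)"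
  using assms by (subst has_derivative_componentwise_within) (auto simp: Basis_vec_def inner_axis)

lemma Ck_on_2_imp_gradient_hessian_on:
  assumes "Ck_on 2 S f"
  shows "\<exists>G H. gradient_hessian_on S f G H"
proof -
  obtain D where
    D: "\<forall>x\<in>S. (f has_derivative (\<lambda>h. \<Sum>i\<in>UNIV. D i x * h $ i)) (at x within S)" "\<forall>i. Ck_on (Suc 0) S (D i)"
    using assms unfolding numeral_2_eq_2 Ck_on.simps(2)[of "Suc 0"] by blast
  then have "\<forall>i. \<exists>E. (\<forall>x\<in>S. (D i has_derivative (\<lambda>h. \<Sum>j\<in>UNIV. E j x * h $ j)) (at x within S)) \<and>
      (\<forall>j. continuous_on S (E j))" by simp
  then obtain E where
    E: "\<And>i x. x \<in> S \<Longrightarrow> (D i has_derivative (\<lambda>h. \<Sum>j\<in>UNIV. E i j x * h $ j)) (at x within S)"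
       "\<And>i j. continuous_on S (E i j)" by metis
  have "((\<lambda>x. \<chi> i. D i x) has_derivative (\<lambda>h. (\<chi> i j. E i j x) *v h)) (at x within S)" if "x \<in> S" for x
    using has_derivative_vec_lambda[of D, OF E(1)[OF that]] by (simp add: matrix_vector_mult_def)
  moreover have "(f has_derivative (\<lambda>h. (\<chi> i. D i x) \<bullet> h)) (at x within S)" if "x \<in> S" for x
    using D(1) that by (simp add: inner_vec_def)
  moreover have "continuous_on S (\<lambda>x. \<chi> i j. E i j x)"
    by (intro continuous_on_vec_lambda E(2))
  ultimately have "gradient_hessian_on S f (\<lambda>x. \<chi> i. D i x) (\<lambda>x. \<chi> i j. E i j x)"
    by (simp add: gradient_hessian_on_def)
  then show ?thesis by (intro exI)
qed

lemma grad_on_eqI: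
  assumes "(f has_derivative (\<lambda>h. g \<bullet> h)) (at x within S)" "x \<in> interior S"
  shows "grad_on S f x = g"
proof -
  have "at x within S = at x" using assms(2) by (rule at_within_interior)
  then have "frechet_derivative f (at x within S) = (\<lambda>h. g \<bullet> h)"
    using assms(1) frechet_derivative_at by metis
  then show ?thesis by (simp add: grad_on_def inner_axis vec_eq_iff)
qed

lemma has_derivative_grad_on:
  assumes "\<And>y. y \<in> S \<Longrightarrow> (f has_derivative (\<lambda>h. G y \<bullet> h)) (at y within S)" "x \<in> interior S"
    and "(G has_derivative G') (at x within S)"
  shows "(grad_on S f has_derivative G') (at x)"
proof -
  have "(G has_derivative G') (at x)" using assms(3) by (simp add: at_within_interior[OF assms(2)])
  then show ?thesis
  proof (rule has_derivative_transform_within_open)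
    show "open (interior S)" "x \<in> interior S" using assms(2) by auto
    show "G y = grad_on S f y" if "y \<in> interior S" for y
      using grad_on_eqI[OF assms(1) that] interior_subset[of S] that by (metis subsetD)
  qed
qed

lemma hessian_on_mult_vec:
  assumes "\<And>y. y \<in> S \<Longrightarrow> (f has_derivative (\<lambda>h. G y \<bullet> h)) (at y within S)" "x \<in> interior S"
    and "(G has_derivative G') (at x within S)"
  shows "hessian_on S f x *v v = G' v"
proof -
  have der: "(grad_on S f has_derivative G') (at x)" by (rule has_derivative_grad_on[OF assms])
  then have "hessian_on S f x = matrix G'"
    using frechet_derivative_at[OF der] by (simp add: hessian_on_def at_within_interior[OF assms(2)])
  moreover have "linear G'" using der has_derivative_linear by blast
  ultimately show ?thesis by (simp add: matrix_works)
qed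

lemma
  assumes "gradient_hessian_on S f G H" "x \<in> interior S"
  shows gradient_hessian_on_grad: "grad_on S f x = G x"
    and gradient_hessian_on_hessian: "hessian_on S f x = H x"
    and gradient_hessian_on_symmetric: "u \<bullet> (H x *v v) = v \<bullet> (H x *v u)"
proof -
  have S: "x \<in> S" using assms(2) interior_subset by blast
  note D1 = gradient_hessian_onD1[OF assms(1)] and D2 = gradient_hessian_onD2[OF assms(1)]
  show "grad_on S f x = G x" by (rule grad_on_eqI[OF D1[OF S] assms(2)])
  show "hessian_on S f x = H x"
    using hessian_on_mult_vec[OF D1 assms(2) D2[OF S]] by (simp add: matrix_eq)
  show "u \<bullet> (H x *v v) = v \<bullet> (H x *v u)"
  proof (rule second_derivative_symmetric[where U = "interior S"])
    show "(f has_derivative (\<lambda>h. G y \<bullet> h)) (at y)" if "y \<in> interior S" for y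
      using D1[of y] interior_subset[of S] that by (auto simp: at_within_interior[OF that])
    show "(G has_derivative (\<lambda>h. H x *v h)) (at x)"
      using D2[OF S] by (simp add: at_within_interior[OF assms(2)])
  qed (use assms(2) in auto)
qed

text \<open>Along the segment both derivatives yield the one-sided derivative of the same function
  of one real variable. This serves at boundary points of the free space, where an inward direction
  provides such a segment.\<close>

lemma has_derivative_within_unique_along_ray:
  fixes f :: "'a::real_normed_vector \<Rightarrow> real"
  assumes A: "(f has_derivative A) (at x within S)" and B: "(f has_derivative B) (at x within S)"
    and ray: "\<And>t. 0 < t \<Longrightarrow> t < d \<Longrightarrow> x + t *\<^sub>R v \<in> S" and d: "0 < d"
  shows "A v = B v"
proof -
  have along: "((\<lambda>t. f (x + t *\<^sub>R v)) has_vector_derivative C v) (at 0 within {0<..<d})"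
    if C: "(f has_derivative C) (at x within S)" for C
  proof -
    have "((\<lambda>t. x + t *\<^sub>R v) has_derivative (\<lambda>t. t *\<^sub>R v)) (at 0 within {0<..<d})"
      by (auto intro!: derivative_eq_intros)
    moreover have "(f has_derivative C) (at (x + 0 *\<^sub>R v) within (\<lambda>t. x + t *\<^sub>R v) ` {0<..<d})"
      using has_derivative_subset[OF C, of "(\<lambda>t. x + t *\<^sub>R v) ` {0<..<d}"] ray
      by (simp add: image_subset_iff)
    ultimately have "((\<lambda>t. f (x + t *\<^sub>R v)) has_derivative (\<lambda>t. C (t *\<^sub>R v))) (at 0 within {0<..<d})"
      by (rule has_derivative_in_compose)
    then show ?thesis
      using has_derivative_linear[OF C] by (simp add: has_vector_derivative_def linear_scale)
  qed
  have "at (0::real) within {0<..<d} \<noteq> bot"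
    using d by (auto simp: trivial_limit_within islimpt_greaterThanLessThan1)
  then show ?thesis
    using vector_derivative_unique_within along[OF A] along[OF B] by blast
qed

section \<open>Compactness bounds, a nondegeneracy criterion and smoothness of real powers\<close>

lemma compact_pos_lower_bound:
  fixes g :: "'a::topological_space \<Rightarrow> real"
  assumes "compact C" "continuous_on C g" "\<And>z. z \<in> C \<Longrightarrow> 0 < g z"
  shows "\<exists>d>0. \<forall>z\<in>C. d \<le> g z"
proof (cases "C = {}")
  case False
  then obtain z where "z \<in> C" "\<forall>y\<in>C. g z \<le> g y"
    using continuous_attains_inf[OF assms(1) _ assms(2)] by blast
  then show ?thesis using assms(3) by blast
qed (auto intro: exI[of _ 1])

lemma compact_upper_bound:
  fixes g :: "'a::topological_space \<Rightarrow> real"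
  assumes "compact C" "continuous_on C g"
  shows "\<exists>M>0. \<forall>z\<in>C. \<bar>g z\<bar> \<le> M"
proof -
  have "bounded (g ` C)" using assms compact_continuous_image compact_imp_bounded by blast
  then show ?thesis by (auto simp: bounded_pos)
qed

text \<open>Split \<open>v\<close> into \<open>a *\<^sub>R n\<close> and a part \<open>u\<close>
  orthogonal to \<open>n\<close>. Pairing \<open>T v = 0\<close> with \<open>n\<close> and with
  \<open>u\<close> and eliminating the cross term by symmetry gives
  \<open>u \<bullet> T u = a\<^sup>2 * (n \<bullet> T n)\<close>. The left side is at most zero and
  the right side at least zero, so \<open>u\<close> and \<open>a\<close> both vanish.\<close>

lemma nondegenerate_if_opposite_signs:
  fixes T :: "'a::real_inner \<Rightarrow> 'a"
  assumes lin: "linear T" and sym: "\<And>u v. u \<bullet> T v = v \<bullet> T u"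
    and pos: "0 < n \<bullet> T n" and neg: "\<And>u. u \<bullet> n = 0 \<Longrightarrow> u \<noteq> 0 \<Longrightarrow> u \<bullet> T u < 0"
    and "T v = 0"
  shows "v = 0"
proof -
  have "n \<noteq> 0" using pos by auto
  define a where "a = (v \<bullet> n) / (n \<bullet> n)"
  define u where "u = v - a *\<^sub>R n"
  have v: "v = a *\<^sub>R n + u" by (simp add: u_def)
  have orth: "u \<bullet> n = 0" using \<open>n \<noteq> 0\<close> by (simp add: u_def a_def inner_diff_left)
  have "T v = a *\<^sub>R T n + T u" unfolding v by (simp add: linear_add[OF lin] linear_scale[OF lin])
  then have "a * (n \<bullet> T n) + n \<bullet> T u = 0" "a * (u \<bullet> T n) + u \<bullet> T u = 0"
    using \<open>T v = 0\<close> by (metis inner_add_right inner_scaleR_right inner_zero_right)+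
  moreover have "n \<bullet> T u = u \<bullet> T n" by (rule sym)
  ultimately have uTu: "u \<bullet> T u = a * (a * (n \<bullet> T n))" by algebra
  also have "\<dots> \<ge> 0" using pos by (simp add: mult.assoc[symmetric])
  finally have "u = 0" using assms(4)[OF orth] by force
  then have "a = 0" using uTu pos by simp
  then show ?thesis using v \<open>u = 0\<close> by simp
qed

lemma Ck_on_powr_pos:
  assumes "Ck_on k S f" "\<And>x. x \<in> S \<Longrightarrow> 0 < f x"
  shows "Ck_on k S (\<lambda>x. f x powr a)"
proof -
  define h where "h j t = (\<Prod>i<j. a - real i) * t powr (a - real j)" for j t
  have "Ck_on k S (\<lambda>x. h 0 (f x))"
  proof (rule Ck_on_compose[where T = "{0<..}", OF assms(1)])
    show "(h j has_real_derivative h (Suc j) t) (at t within {0<..})" if "t \<in> {0<..}" for j t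
    proof -
      have "((\<lambda>t. t powr (a - real j)) has_real_derivative (a - real j) * t powr (a - real (Suc j))) (at t)"
        using has_real_derivative_powr[of t "a - real j"] that by (simp add: algebra_simps)
      from DERIV_cmult[OF this, of "\<Prod>i<j. a - real i"] show ?thesis
        unfolding h_def by (simp add: mult.assoc has_field_derivative_at_within)
    qed
    show "continuous_on {0<..} (h k)"
      unfolding h_def by (intro continuous_intros) auto
  qed (use assms in auto)
  then show ?thesis by (simp add: h_def)
qed

text \<open>All derivatives up to order \<open>k\<close> carry positive exponents
  \<open>a - real j\<close>, hence are continuous at \<open>0\<close>. For \<open>a = real k\<close>
  the last one would be a multiple of \<open>t powr 0\<close>, which jumps from \<open>0\<close> at
  \<open>t = 0\<close> to \<open>1\<close> for \<open>t > 0\<close>. The threshold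
  \<open>2 < k\<close> for the potential comes from here, since the objective may vanish at its
  minimizer.\<close>

lemma Ck_on_powr_nonneg:
  assumes "Ck_on k S f" "\<And>x. x \<in> S \<Longrightarrow> 0 \<le> f x" "real k < a"
  shows "Ck_on k S (\<lambda>x. f x powr a)"
proof -
  define h where "h j t = (\<Prod>i<j. a - real i) * t powr (a - real j)" for j t
  have "Ck_on k S (\<lambda>x. h 0 (f x))"
  proof (rule Ck_on_compose[where T = "{0..}", OF assms(1)])
    show "(h j has_real_derivative h (Suc j) t) (at t within {0..})" if "j < k" "t \<in> {0..}" for j t
    proof -
      have "((\<lambda>t. t powr (a - real j)) has_real_derivative (a - real j) * t powr (a - real (Suc j))) (at t within {0..})"
        using has_real_derivative_powr_nonneg[of t "a - real j"] that assms(3) by (simp add: algebra_simps)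
      from DERIV_cmult[OF this, of "\<Prod>i<j. a - real i"] show ?thesis
        unfolding h_def by (simp add: mult.assoc)
    qed
    show "continuous_on {0..} (h k)"
      unfolding h_def
      by (intro continuous_on_mult continuous_on_const continuous_on_powr' continuous_on_id)
         (use assms(3) in auto)
  qed (use assms in auto)
  then show ?thesis by (simp add: h_def)
qed

lemma open_contains_segment_germ:
  fixes x v :: "'a::real_normed_vector"
  assumes "open U" "x \<in> U"
  shows "\<exists>d>0. \<forall>s. \<bar>s\<bar> < d \<longrightarrow> x + s *\<^sub>R v \<in> U"
proof -
  obtain e where e: "e > 0" "ball x e \<subseteq> U" using assms openE by blast
  define d where "d = e / (norm v + 1)"
  have n: "norm v + 1 > 0" by (simp add: add_nonneg_pos)
  have "x + s *\<^sub>R v \<in> U" if "\<bar>s\<bar> < d" for s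
  proof -
    have "\<bar>s\<bar> * norm v \<le> \<bar>s\<bar> * (norm v + 1)" by (simp add: mult_left_mono)
    also have "\<dots> < e" using that n by (simp add: d_def pos_less_divide_eq)
    finally show ?thesis using e by (auto simp: dist_norm subset_iff)
  qed
  moreover have "d > 0" using e n by (simp add: d_def)
  ultimately show ?thesis by blast
qed

subsection \<open>The gradient of the potential\<close>

text \<open>The individual obstacles survive only in the last three assumptions.
  \<open>boundary_curvature\<close> is asked only where
  \<open>0 \<le> GB x \<bullet> (x - p)\<close>, which leaves out the outer boundary. It is
  multiplied out by the squared distance and is invariant under positive scaling of
  \<open>GB\<close> and \<open>HB\<close>, so that a condition on a single \<open>\<beta> i\<close>
  transfers to the product.\<close>

locale obstacle_potential =
  fixes f B :: "real^'n \<Rightarrow> real" and Gf GB :: "real^'n \<Rightarrow> real^'n"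
    and Hf HB :: "real^'n \<Rightarrow> real^'n^'n" and p :: "real^'n" and l L :: real
    and F :: "(real^'n) set"
  assumes F_eq: "F = {x. 0 \<le> B x}" and compact_F: "compact F" and interior_F: "interior F = {x. 0 < B x}"
    and Ck_f: "Ck_on 2 F f" and Ck_B: "Ck_on 2 F B"
    and f_deriv: "gradient_hessian_on F f Gf Hf" and B_deriv: "gradient_hessian_on UNIV B GB HB"
    and B_p: "0 < B p" and Gf_p: "Gf p = 0"
    and f_nonneg: "x \<in> F \<Longrightarrow> 0 \<le> f x" and f_pos: "x \<in> F \<Longrightarrow> x \<noteq> p \<Longrightarrow> 0 < f x"
    and l_pos: "0 < l" and l_le_L: "l \<le> L"
    and Gf_mono: "0 < B x \<Longrightarrow> l * (norm (x - p))\<^sup>2 \<le> Gf x \<bullet> (x - p)"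
    and Hf_ge: "0 < B x \<Longrightarrow> l * (norm v)\<^sup>2 \<le> v \<bullet> (Hf x *v v)"
    and Hf_le: "0 < B x \<Longrightarrow> v \<bullet> (Hf x *v v) \<le> L * (norm v)\<^sup>2"
    and boundary_regular: "B x = 0 \<Longrightarrow> GB x \<noteq> 0"
    and boundary_curvature: "\<lbrakk>B x = 0; norm v = 1; GB x \<bullet> v = 0; 0 \<le> GB x \<bullet> (x - p)\<rbrakk> \<Longrightarrow>
      L / l * (GB x \<bullet> (x - p)) < (norm (x - p))\<^sup>2 * (v \<bullet> (HB x *v v))"
    and boundary_dim_1: "CARD('n) = 1 \<Longrightarrow> B x = 0 \<Longrightarrow> GB x \<bullet> (x - p) < 0"
begin

definition phi :: "real \<Rightarrow> real^'n \<Rightarrow> real" where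
  "phi k x = f x / (f x powr k + B x) powr (1 / k)"

definition N :: "real \<Rightarrow> real^'n \<Rightarrow> real^'n" where
  "N k x = B x *\<^sub>R Gf x - (f x / k) *\<^sub>R GB x"

definition DN :: "real \<Rightarrow> real^'n \<Rightarrow> real^'n \<Rightarrow> real^'n" where
  "DN k x v = (GB x \<bullet> v) *\<^sub>R Gf x + B x *\<^sub>R (Hf x *v v) - ((Gf x \<bullet> v) / k) *\<^sub>R GB x - (f x / k) *\<^sub>R (HB x *v v)"

definition weight :: "real \<Rightarrow> real^'n \<Rightarrow> real" where
  "weight k x = (f x powr k + B x) powr (- (1 / k) - 1)"

lemma F_iff: "x \<in> F \<longleftrightarrow> 0 \<le> B x" by (simp add: F_eq)

lemma int_F: "0 < B x \<Longrightarrow> x \<in> interior F" by (simp add: interior_F)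

lemma at_F: "0 < B x \<Longrightarrow> at x within F = at x" by (simp add: at_within_interior[OF int_F])

lemma open_B_pos: "open {x. 0 < B x}" using interior_F by (metis open_interior)

lemmas f_der = gradient_hessian_onD1[OF f_deriv]
  and Gf_der = gradient_hessian_onD2[OF f_deriv]
  and cont_f = gradient_hessian_on_continuous(1)[OF f_deriv]
  and cont_Gf = gradient_hessian_on_continuous(2)[OF f_deriv]

lemma B_der_at: "(B has_derivative (\<lambda>h. GB x \<bullet> h)) (at x)"
  using gradient_hessian_onD1[OF B_deriv, of x] by simp

lemma B_deriv_F: "gradient_hessian_on F B GB HB"
  by (rule gradient_hessian_on_subset[OF B_deriv]) simp

lemmas B_der = gradient_hessian_onD1[OF B_deriv_F]
  and GB_der = gradient_hessian_onD2[OF B_deriv_F]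
  and cont_HB = gradient_hessian_onD3[OF B_deriv_F]
  and cont_B = gradient_hessian_on_continuous(1)[OF B_deriv_F]
  and cont_GB = gradient_hessian_on_continuous(2)[OF B_deriv_F]

lemma Hf_sym: "0 < B x \<Longrightarrow> u \<bullet> (Hf x *v v) = v \<bullet> (Hf x *v u)"
  by (rule gradient_hessian_on_symmetric[OF f_deriv int_F])

lemma HB_sym: "u \<bullet> (HB x *v v) = v \<bullet> (HB x *v u)"
  by (rule gradient_hessian_on_symmetric[OF B_deriv]) simp

text \<open>\<open>f\<close> can vanish only at \<open>p\<close>, and there \<open>B\<close> is
  positive.\<close>

lemma denom_pos: "x \<in> F \<Longrightarrow> 0 < f x powr k + B x"
  using f_pos[of x] B_p by (cases "x = p") (auto simp: F_iff add_pos_nonneg add_nonneg_pos)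

lemma weight_pos: "x \<in> F \<Longrightarrow> 0 < weight k x"
  using denom_pos[of x k] by (simp add: weight_def)

lemma denom_has_derivative:
  assumes "x \<in> F" "1 < k"
  shows "((\<lambda>x. f x powr k + B x) has_derivative
    (\<lambda>h. k * f x powr (k - 1) * (Gf x \<bullet> h) + GB x \<bullet> h)) (at x within F)"
proof -
  have "((\<lambda>t. t powr k) has_derivative (*) (k * f x powr (k - 1))) (at (f x) within f ` F)"
    using has_real_derivative_powr_nonneg[of "f x" k] f_nonneg assms
    by (intro has_derivative_subset[where s = "{0..}" and t = "f ` F"])
       (auto simp: has_field_derivative_def)
  from has_derivative_add[OF has_derivative_in_compose[OF f_der[OF assms(1)] this] B_der[OF assms(1)]]
  show ?thesis by simp
qed

lemma denom_powr_has_derivative: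
  assumes "x \<in> F" "1 < k"
  shows "((\<lambda>x. (f x powr k + B x) powr a) has_derivative
    (\<lambda>h. a * (f x powr k + B x) powr (a - 1) * (k * f x powr (k - 1) * (Gf x \<bullet> h) + GB x \<bullet> h)))
    (at x within F)"
  using has_derivative_compose[OF denom_has_derivative[OF assms]
      has_real_derivative_powr[OF denom_pos[OF assms(1)], unfolded has_field_derivative_def]] .

lemma phi_eq: "phi k x = f x * (f x powr k + B x) powr (- (1 / k))"
  by (simp add: phi_def powr_minus_divide)

text \<open>In the product rule the two terms with \<open>f x powr k\<close> cancel. What remains
  besides the positive \<open>weight\<close> depends on \<open>k\<close> only through the factor
  \<open>1 / k\<close>, which makes \<open>N\<close> the convenient object for the second-order
  analysis.\<close>

lemma phi_has_derivative:
  assumes "x \<in> F" "1 < k"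
  shows "(phi k has_derivative (\<lambda>h. (weight k x *\<^sub>R N k x) \<bullet> h)) (at x within F)"
proof -
  let ?P = "f x powr k + B x"
  have P: "?P powr (- (1 / k)) = weight k x * ?P"
    using powr_mult_base[of ?P "- (1 / k) - 1"] denom_pos[OF assms(1), of k]
    by (simp add: weight_def mult.commute)
  have fk: "f x * f x powr (k - 1) = f x powr k"
    using powr_mult_base[of "f x" "k - 1"] f_nonneg[OF assms(1)] by simp
  have "f x * (- (1 / k) * weight k x * (k * f x powr (k - 1) * (Gf x \<bullet> h) + GB x \<bullet> h)) +
      (Gf x \<bullet> h) * ?P powr (- (1 / k)) = (weight k x *\<^sub>R N k x) \<bullet> h" for h
  proof -
    have "f x * (- (1 / k) * weight k x * (k * f x powr (k - 1) * (Gf x \<bullet> h) + GB x \<bullet> h)) =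
      - weight k x * ((f x * f x powr (k - 1)) * (Gf x \<bullet> h) + f x / k * (GB x \<bullet> h))"
      using assms by (simp add: field_simps)
    then show ?thesis unfolding P fk
      by (simp add: N_def inner_diff_left algebra_simps)
  qed
  moreover have "(phi k has_derivative (\<lambda>h. f x * (- (1 / k) * weight k x * (k * f x powr (k - 1) * (Gf x \<bullet> h) + GB x \<bullet> h)) +
      (Gf x \<bullet> h) * ?P powr (- (1 / k)))) (at x within F)"
    using has_derivative_mult[OF f_der[OF assms(1)] denom_powr_has_derivative[OF assms, of "- (1 / k)"]]
    unfolding phi_eq[abs_def] weight_def .
  ultimately show ?thesis by (simp only:)
qed

lemma Ck_phi: "2 < k \<Longrightarrow> Ck_on 2 F (phi k)"
  unfolding phi_eq[abs_def]
  by (intro Ck_on_mult Ck_f Ck_on_powr_pos Ck_on_add Ck_B Ck_on_powr_nonneg)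
     (auto simp: f_nonneg denom_pos)

lemma N_has_derivative:
  assumes "x \<in> F"
  shows "(N k has_derivative DN k x) (at x within F)"
proof -
  have "((\<lambda>x. B x *\<^sub>R Gf x - (f x / k) *\<^sub>R GB x) has_derivative
     (\<lambda>h. (B x *\<^sub>R (Hf x *v h) + (GB x \<bullet> h) *\<^sub>R Gf x) -
       ((f x / k) *\<^sub>R (HB x *v h) + ((Gf x \<bullet> h) / k) *\<^sub>R GB x))) (at x within F)"
    by (intro has_derivative_diff has_derivative_scaleR Gf_der GB_der B_der assms
        has_derivative_divide' bounded_linear.has_derivative[OF bounded_linear_divide] f_der)
  then show ?thesis unfolding N_def[abs_def] by (rule has_derivative_eq_rhs) (auto simp: DN_def)
qed

lemma linear_DN: "linear (DN k x)" if "x \<in> F"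
  using N_has_derivative[OF that] has_derivative_linear by blast

lemma grad_phi: "0 < B x \<Longrightarrow> 1 < k \<Longrightarrow> grad_on F (phi k) x = weight k x *\<^sub>R N k x"
  by (rule grad_on_eqI[OF phi_has_derivative]) (auto simp: F_iff int_F)

text \<open>The product rule also produces a derivative of \<open>weight\<close>, but it multiplies
  \<open>N k x\<close>, which is zero here.\<close>

lemma hessian_phi:
  assumes "0 < B x" "1 < k" "N k x = 0"
  shows "hessian_on F (phi k) x *v v = weight k x *\<^sub>R DN k x v"
proof -
  have x: "x \<in> F" using assms by (simp add: F_iff)
  obtain W where "(weight k has_derivative W) (at x within F)"
    using denom_powr_has_derivative[OF x assms(2), of "- (1 / k) - 1"] unfolding weight_def[abs_def] by blast
  from has_derivative_scaleR[OF this N_has_derivative[OF x, of k]]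
  have "((\<lambda>x. weight k x *\<^sub>R N k x) has_derivative (\<lambda>h. weight k x *\<^sub>R DN k x h)) (at x within F)"
    using assms(3) by simp
  from hessian_on_mult_vec[OF phi_has_derivative[OF _ assms(2)] int_F[OF assms(1)] this]
  show ?thesis by simp
qed

lemma hessian_phi_invertible:
  assumes "0 < B x" "1 < k" "N k x = 0" "\<And>v. DN k x v = 0 \<Longrightarrow> v = 0"
  shows "invertible (hessian_on F (phi k) x)"
  unfolding invertible_left_inverse matrix_left_invertible_ker
  using assms weight_pos[of x k] by (auto simp: hessian_phi F_iff)

section \<open>The potential at the boundary and at local minima\<close>

lemma B_pos_along_gradient:
  assumes "B x = 0"
  shows "\<exists>d>0. \<forall>t. 0 < t \<and> t < d \<longrightarrow> 0 < B (x + t *\<^sub>R GB x)"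
proof -
  have "((\<lambda>t. B (x + t *\<^sub>R GB x)) has_real_derivative GB x \<bullet> GB x) (at 0)"
    using has_real_derivative_along_line[of B "GB x" x 0 "GB x"] B_der_at[of x] by simp
  from DERIV_pos_inc_right[OF this] show ?thesis
    using boundary_regular[OF assms] assms by auto
qed

lemma phi_boundary: "B x = 0 \<Longrightarrow> 1 < k \<Longrightarrow> phi k x = 1"
proof -
  assume x: "B x = 0" and k: "1 < k"
  then have "x \<noteq> p" using B_p by auto
  then have "0 < f x" using x f_pos by (simp add: F_iff)
  then show ?thesis using x k by (simp add: phi_def powr_powr)
qed

lemma phi_interior: "0 < B x \<Longrightarrow> 1 < k \<Longrightarrow> phi k x < 1"
proof -
  assume x: "0 < B x" and k: "1 < k"
  have "0 \<le> f x" using x f_nonneg by (simp add: F_iff)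
  then have "f x = (f x powr k) powr (1 / k)" using k by (simp add: powr_powr)
  also have "\<dots> < (f x powr k + B x) powr (1 / k)" using x k by (intro powr_less_mono2) auto
  finally show ?thesis using \<open>0 \<le> f x\<close> by (simp add: phi_def divide_less_eq_1)
qed

lemma phi_nonneg: "x \<in> F \<Longrightarrow> 0 \<le> phi k x"
  using f_nonneg by (simp add: phi_def)

text \<open>The derivative chosen by \<open>grad_on\<close> is compared with the computed one along
  the inward direction \<open>GB x\<close> alone. There the computed value is
  \<open>- weight k x * (f x / k) * (GB x \<bullet> GB x)\<close>, which is nonzero, whereas a zero
  gradient makes the chosen derivative vanish in every direction.\<close>

lemma grad_phi_boundary:
  assumes x: "B x = 0" and k: "1 < k"
  shows "grad_on F (phi k) x \<noteq> 0"
proof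
  assume g0: "grad_on F (phi k) x = 0"
  have xF: "x \<in> F" using x by (simp add: F_iff)
  let ?A = "frechet_derivative (phi k) (at x within F)"
  have A: "(phi k has_derivative ?A) (at x within F)"
    using phi_has_derivative[OF xF k] frechet_derivative_works differentiableI by blast
  have lin: "linear ?A" using A has_derivative_linear by blast
  have "?A (axis i 1) = 0" for i
    using g0 by (metis grad_on_def vec_lambda_beta zero_index)
  then have "?A b = 0" if "b \<in> Basis" for b
    using that by (auto simp: Basis_vec_def)
  then have A0: "?A v = 0" for v
    using linear_eq_stdbasis[OF lin linear_zero] by (metis)
  obtain d where d: "d > 0" "\<And>t. 0 < t \<Longrightarrow> t < d \<Longrightarrow> 0 < B (x + t *\<^sub>R GB x)"
    using B_pos_along_gradient[OF x] by auto
  have "?A (GB x) = (weight k x *\<^sub>R N k x) \<bullet> GB x"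
    by (rule has_derivative_within_unique_along_ray[OF A phi_has_derivative[OF xF k] _ d(1)])
       (use d(2) in \<open>force simp: F_iff\<close>)
  then have "f x * (GB x \<bullet> GB x) = 0"
    using weight_pos[OF xF, of k] k x A0 by (simp add: N_def)
  moreover have "x \<noteq> p" using x B_p by auto
  ultimately show False using f_pos[OF xF] boundary_regular[OF x] by auto
qed

text \<open>The boundary lies at level \<open>1\<close> and interior points lie strictly lower, so
  any short step along \<open>GB x\<close> decreases the potential.\<close>

lemma local_min_imp_interior:
  assumes "local_min_on F (phi k) x" "1 < k"
  shows "0 < B x"
proof (rule ccontr)
  assume "\<not> 0 < B x"
  then have x: "B x = 0" using assms(1) by (simp add: local_min_on_def F_iff)
  obtain r where r: "r > 0" "\<And>y. y \<in> F \<inter> ball x r \<Longrightarrow> phi k x \<le> phi k y"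
    using assms(1) by (auto simp: local_min_on_def)
  obtain d where d: "d > 0" "\<And>t. 0 < t \<Longrightarrow> t < d \<Longrightarrow> 0 < B (x + t *\<^sub>R GB x)"
    using B_pos_along_gradient[OF x] by auto
  obtain e where e: "e > 0" "\<And>t. \<bar>t\<bar> < e \<Longrightarrow> x + t *\<^sub>R GB x \<in> ball x r"
    using open_contains_segment_germ[of "ball x r" x "GB x"] r(1) by auto
  define t where "t = min d e / 2"
  have t: "0 < t" "t < d" "\<bar>t\<bar> < e" using d(1) e(1) by (auto simp: t_def)
  have "phi k x \<le> phi k (x + t *\<^sub>R GB x)"
    using r(2)[of "x + t *\<^sub>R GB x"] e(2)[OF t(3)] d(2)[OF t(1,2)] by (auto simp: F_iff)
  then show False using phi_boundary[OF x assms(2)] phi_interior[OF d(2)[OF t(1,2)] assms(2)] by simp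
qed

lemma phi_along_line:
  assumes "0 < B (x + s *\<^sub>R v)" "1 < k"
  shows "((\<lambda>s. phi k (x + s *\<^sub>R v)) has_real_derivative
    weight k (x + s *\<^sub>R v) * (N k (x + s *\<^sub>R v) \<bullet> v)) (at s)"
proof -
  have "(phi k has_derivative (\<lambda>h. (weight k (x + s *\<^sub>R v) *\<^sub>R N k (x + s *\<^sub>R v)) \<bullet> h)) (at (x + s *\<^sub>R v))"
    using phi_has_derivative[of "x + s *\<^sub>R v" k] at_F[OF assms(1)] assms by (simp add: F_iff)
  from has_real_derivative_along_line[OF this] show ?thesis by simp
qed

text \<open>The second-order condition is read off from \<open>N\<close>: if the form were negative
  at \<open>v\<close>, then \<open>N \<bullet> v\<close>, which is zero at \<open>x\<close>, would
  be negative just beyond \<open>x\<close> in direction \<open>v\<close>. Since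
  \<open>weight\<close> is positive, the potential would strictly decrease there.\<close>

lemma
  assumes "local_min_on F (phi k) x" "1 < k"
  shows local_min_imp_N: "N k x = 0" and local_min_imp_DN: "0 \<le> v \<bullet> DN k x v"
proof -
  have Bx: "0 < B x" by (rule local_min_imp_interior[OF assms])
  then have xF: "x \<in> F" by (simp add: F_iff)
  obtain r where r: "r > 0" "\<And>y. y \<in> F \<inter> ball x r \<Longrightarrow> phi k x \<le> phi k y"
    using assms(1) by (auto simp: local_min_on_def)
  have germ: "\<exists>d>0. \<forall>s. \<bar>s\<bar> < d \<longrightarrow> 0 < B (x + s *\<^sub>R v) \<and> phi k x \<le> phi k (x + s *\<^sub>R v)" for v
  proof -
    have "open ({x. 0 < B x} \<inter> ball x r)" using open_B_pos by auto
    from open_contains_segment_germ[OF this, of x v] Bx r show ?thesis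
      by (auto simp: F_iff) (metis less_imp_le)
  qed
  have "weight k x * (N k x \<bullet> v) = 0" for v
  proof -
    obtain d where d: "d > 0" "\<And>s. \<bar>s\<bar> < d \<Longrightarrow> phi k x \<le> phi k (x + s *\<^sub>R v)" using germ by blast
    have "((\<lambda>s. phi k (x + s *\<^sub>R v)) has_real_derivative weight k x * (N k x \<bullet> v)) (at 0)"
      using phi_along_line[of x 0 v k] Bx assms(2) by simp
    from DERIV_local_min[OF this d(1)] d(2) show ?thesis by auto
  qed
  then have "N k x \<bullet> v = 0" for v using weight_pos[OF xF, of k] by simp
  then show N0: "N k x = 0" using inner_eq_zero_iff by blast
  show "0 \<le> v \<bullet> DN k x v"
  proof (rule ccontr)
    assume "\<not> 0 \<le> v \<bullet> DN k x v"
    then have neg: "DN k x v \<bullet> v < 0" by (simp add: inner_commute)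
    have "((\<lambda>s. x + s *\<^sub>R v) has_derivative (\<lambda>s. s *\<^sub>R v)) (at 0)" by (auto intro!: derivative_eq_intros)
    moreover have "(N k has_derivative DN k x) (at (x + 0 *\<^sub>R v))"
      using N_has_derivative[OF xF, of k] by (simp add: at_F[OF Bx])
    ultimately have "((\<lambda>s. N k (x + s *\<^sub>R v)) has_derivative (\<lambda>s. DN k x (s *\<^sub>R v))) (at 0)"
      by (rule has_derivative_compose)
    from has_derivative_inner_left[OF this, of v]
    have "((\<lambda>s. N k (x + s *\<^sub>R v) \<bullet> v) has_real_derivative DN k x v \<bullet> v) (at 0)"
      by (simp add: has_field_derivative_def linear_scale[OF linear_DN[OF xF]] mult_commute_abs)
    from DERIV_neg_dec_right[OF this neg]
    obtain d1 where d1: "d1 > 0" "\<And>s. 0 < s \<Longrightarrow> s < d1 \<Longrightarrow> N k (x + s *\<^sub>R v) \<bullet> v < 0"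
      using N0 by auto
    obtain d2 where d2: "d2 > 0" "\<And>s. \<bar>s\<bar> < d2 \<Longrightarrow> 0 < B (x + s *\<^sub>R v)"
      "\<And>s. \<bar>s\<bar> < d2 \<Longrightarrow> phi k x \<le> phi k (x + s *\<^sub>R v)" using germ by metis
    define t where "t = min d1 d2 / 2"
    have t: "0 < t" "t < d1" "t < d2" using d1(1) d2(1) by (auto simp: t_def)
    note der = phi_along_line[OF d2(2) assms(2)]
    have "phi k (x + t *\<^sub>R v) < phi k (x + 0 *\<^sub>R v)"
    proof (rule DERIV_neg_imp_decreasing_open[OF t(1)])
      show "\<exists>y. ((\<lambda>s. phi k (x + s *\<^sub>R v)) has_real_derivative y) (at s) \<and> y < 0" if "0 < s" "s < t" for s
      proof (intro exI conjI)
        show "((\<lambda>s. phi k (x + s *\<^sub>R v)) has_real_derivative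
          weight k (x + s *\<^sub>R v) * (N k (x + s *\<^sub>R v) \<bullet> v)) (at s)" using that t by (intro der) auto
        show "weight k (x + s *\<^sub>R v) * (N k (x + s *\<^sub>R v) \<bullet> v) < 0"
          using that t d1(2)[of s] d2(2)[of s] by (intro mult_pos_neg weight_pos) (auto simp: F_iff)
      qed
      have "isCont (\<lambda>s. phi k (x + s *\<^sub>R v)) s" if "0 \<le> s" "s \<le> t" for s
        using der[of s] that t DERIV_isCont by fastforce
      then show "continuous_on {0..t} (\<lambda>s. phi k (x + s *\<^sub>R v))"
        by (auto intro: continuous_at_imp_continuous_on)
    qed
    then show False using d2(3)[of t] t by simp
  qed
qed

subsection \<open>Critical points for large \<open>k\<close>\<close>

lemma continuous_on_HB_form:
  "continuous_on (F \<times> sphere 0 1) (\<lambda>z. snd z \<bullet> (HB (fst z) *v snd z))"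
proof -
  have "continuous_on (F \<times> sphere 0 1) (\<lambda>z. HB (fst z) *v snd z)"
    unfolding matrix_vector_mult_def
    by (intro continuous_on_vec_lambda continuous_on_sum continuous_on_mult continuous_on_component
        continuous_on_compose2[OF cont_HB] continuous_on_fst continuous_on_snd continuous_on_id) auto
  then show ?thesis by (intro continuous_on_inner continuous_on_snd continuous_on_id)
qed

lemma uniform_bound:
  "\<exists>M>0. \<forall>x\<in>F. f x \<le> M \<and> norm (Gf x) \<le> M \<and> norm (GB x) \<le> M \<and> (\<forall>v. \<bar>v \<bullet> (HB x *v v)\<bar> \<le> M * (norm v)\<^sup>2)"
proof -
  obtain M1 where "\<forall>z\<in>F \<times> sphere 0 1. \<bar>snd z \<bullet> (HB (fst z) *v snd z)\<bar> \<le> M1"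
    using compact_upper_bound[OF compact_Times[OF compact_F compact_sphere] continuous_on_HB_form] by blast
  then have M1: "\<bar>v \<bullet> (HB x *v v)\<bar> \<le> M1" if "x \<in> F" "norm v = 1" for x v
    using that by force
  obtain M2 where M2: "\<And>x. x \<in> F \<Longrightarrow> \<bar>f x\<bar> \<le> M2"
    using compact_upper_bound[OF compact_F cont_f] by auto
  obtain M3 where M3: "\<And>x. x \<in> F \<Longrightarrow> \<bar>norm (Gf x)\<bar> \<le> M3"
    using compact_upper_bound[OF compact_F continuous_on_norm[OF cont_Gf]] by auto
  obtain M4 where M4: "M4 > 0" "\<And>x. x \<in> F \<Longrightarrow> \<bar>norm (GB x)\<bar> \<le> M4"
    using compact_upper_bound[OF compact_F continuous_on_norm[OF cont_GB]] by auto
  define M where "M = max (max M1 M2) (max M3 M4)"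
  have "\<bar>v \<bullet> (HB x *v v)\<bar> \<le> M * (norm v)\<^sup>2" if x: "x \<in> F" for x v
  proof (cases "v = 0")
    case False
    define u where "u = (1 / norm v) *\<^sub>R v"
    have "norm u = 1" using False by (simp add: u_def)
    then have "\<bar>u \<bullet> (HB x *v u)\<bar> \<le> M" using M1[OF x] by (force simp: M_def)
    then have "\<bar>u \<bullet> (HB x *v u)\<bar> * (norm v)\<^sup>2 \<le> M * (norm v)\<^sup>2" by (rule mult_right_mono) simp
    moreover have "v \<bullet> (HB x *v v) = (u \<bullet> (HB x *v u)) * (norm v)\<^sup>2"
      using False by (simp add: u_def matrix_vector_mult_scaleR power2_eq_square)
    ultimately show ?thesis by (simp add: abs_mult)
  qed simp
  moreover have "f x \<le> M \<and> norm (Gf x) \<le> M \<and> norm (GB x) \<le> M" if x: "x \<in> F" for x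
    using M2[OF x] M3[OF x] M4(2)[OF x] by (auto simp: M_def)
  moreover have "M > 0" using M4(1) by (simp add: M_def)
  ultimately show ?thesis by blast
qed

lemma inner_DN:
  "v \<bullet> DN k x v = (GB x \<bullet> v) * (Gf x \<bullet> v) + B x * (v \<bullet> (Hf x *v v))
     - (Gf x \<bullet> v) * (GB x \<bullet> v) / k - f x / k * (v \<bullet> (HB x *v v))"
  by (simp add: DN_def inner_diff_right inner_add_right inner_commute)

lemma p_in_F: "p \<in> F" using B_p by (simp add: F_iff)

text \<open>The term with \<open>Hf\<close> dominates: the other term free of \<open>k\<close>
  contains \<open>Gf\<close>, which vanishes at \<open>p\<close>, and the rest is of order
  \<open>1 / k\<close>. The radius is fixed before \<open>k\<close>, so that the estimate away from
  \<open>p\<close> can be invoked with the same radius.\<close>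

lemma strongly_monotone_near_minimizer:
  assumes "0 < e"
  shows "\<exists>r>0. \<exists>K. r \<le> e \<and> ball p r \<subseteq> {x. 0 < B x} \<and>
    (\<forall>k>K. \<forall>x\<in>ball p r. \<forall>v. v \<noteq> 0 \<longrightarrow> 0 < v \<bullet> DN k x v)"
proof -
  obtain M where M: "M > 0" "\<And>x. x \<in> F \<Longrightarrow> f x \<le> M" "\<And>x. x \<in> F \<Longrightarrow> norm (Gf x) \<le> M"
    "\<And>x. x \<in> F \<Longrightarrow> norm (GB x) \<le> M" "\<And>x v. x \<in> F \<Longrightarrow> \<bar>v \<bullet> (HB x *v v)\<bar> \<le> M * (norm v)\<^sup>2"
    using uniform_bound by auto
  \<comment> \<open>A lower bound on unit vectors for the part of \<open>inner_DN\<close> that is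
    free of \<open>k\<close>. At \<open>p\<close> it equals \<open>B p * l\<close>, twice the
    constant \<open>c\<close> below.\<close>
  define q where "q x = B x * l - norm (GB x) * norm (Gf x)" for x
  define c where "c = B p * l / 2"
  have c: "c > 0" using B_p l_pos by (simp add: c_def)
  have "q p > c" using B_p l_pos by (simp add: q_def Gf_p c_def)
  have "continuous_on F q" unfolding q_def
    by (intro continuous_intros cont_B cont_Gf cont_GB)
  then have "continuous_on {x. 0 < B x} q"
    by (rule continuous_on_subset) (auto simp: F_iff)
  then have "open {x \<in> {x. 0 < B x}. q x > c}"
    using open_B_pos continuous_on_open_gen continuous_openin_preimage_gen[of "{x. 0 < B x}" q "{c<..}"]
    by (auto simp: vimage_def Int_def openin_open_eq)
  then obtain r0 where r0: "r0 > 0" "ball p r0 \<subseteq> {x \<in> {x. 0 < B x}. q x > c}"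
    using \<open>q p > c\<close> B_p openE[of "{x \<in> {x. 0 < B x}. q x > c}" p] by auto
  define r where "r = min r0 e"
  \<comment> \<open>The two terms of \<open>inner_DN\<close> with a factor \<open>1 / k\<close> are
    each at most \<open>M\<^sup>2 / k\<close> on unit vectors; beyond \<open>K\<close> their sum
    stays below \<open>c\<close>.\<close>
  define K where "K = max 0 (2 * M\<^sup>2 / c)"
  have pos: "0 < v \<bullet> DN k x v" if k: "k > K" and x: "x \<in> ball p r" and v: "v \<noteq> 0" for k x v
  proof -
    have Bx: "0 < B x" and qx: "q x > c" using r0(2) x by (auto simp: r_def)
    then have xF: "x \<in> F" by (simp add: F_iff)
    have k0: "k > 0" and "2 * M\<^sup>2 / c < k" using k by (auto simp: K_def)
    then have kc: "2 * M\<^sup>2 / k < c" using c by (simp add: pos_divide_less_eq mult.commute)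
    let ?n = "(norm v)\<^sup>2"
    have n: "?n > 0" using v by simp
    have G: "\<bar>(GB x \<bullet> v) * (Gf x \<bullet> v)\<bar> \<le> norm (GB x) * norm (Gf x) * ?n"
    proof -
      have "\<bar>(GB x \<bullet> v) * (Gf x \<bullet> v)\<bar> \<le> (norm (GB x) * norm v) * (norm (Gf x) * norm v)"
        unfolding abs_mult by (intro mult_mono Cauchy_Schwarz_ineq2) auto
      then show ?thesis by (simp add: power2_eq_square mult_ac)
    qed
    have G': "norm (GB x) * norm (Gf x) \<le> M\<^sup>2"
      unfolding power2_eq_square using M(3,4)[OF xF] M(1) by (intro mult_mono) auto
    have "(Gf x \<bullet> v) * (GB x \<bullet> v) \<le> M\<^sup>2 * ?n"
      using G mult_right_mono[OF G', of ?n] by (simp add: mult.commute)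
    then have t3: "(Gf x \<bullet> v) * (GB x \<bullet> v) / k \<le> M\<^sup>2 * ?n / k"
      using k0 by (simp add: divide_right_mono)
    have "f x * (v \<bullet> (HB x *v v)) \<le> f x * (M * ?n)"
      using M(5)[OF xF, of v] f_nonneg[OF xF] by (intro mult_left_mono) auto
    also have "\<dots> \<le> M * (M * ?n)" using M(1,2) xF by (intro mult_right_mono) auto
    finally have t4: "f x / k * (v \<bullet> (HB x *v v)) \<le> M\<^sup>2 * ?n / k"
      using k0 by (simp add: divide_right_mono power2_eq_square mult.assoc)
    have t2: "B x * (v \<bullet> (Hf x *v v)) \<ge> B x * (l * ?n)"
      using Hf_ge[OF Bx] Bx by (intro mult_left_mono) auto
    have "v \<bullet> DN k x v \<ge> q x * ?n - 2 * M\<^sup>2 / k * ?n"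
    proof -
      have "q x * ?n - 2 * M\<^sup>2 / k * ?n =
          B x * (l * ?n) - norm (GB x) * norm (Gf x) * ?n - (M\<^sup>2 * ?n / k + M\<^sup>2 * ?n / k)"
        by (simp add: q_def algebra_simps)
      also have "\<dots> \<le> v \<bullet> DN k x v"
        unfolding inner_DN using abs_le_D2[OF G] t2 t3 t4 by linarith
      finally show ?thesis .
    qed
    moreover have "q x * ?n - 2 * M\<^sup>2 / k * ?n > 0"
      unfolding left_diff_distrib[symmetric] using qx kc n by (intro mult_pos_pos) auto
    ultimately show ?thesis by linarith
  qed
  show ?thesis
    by (rule exI[of _ r], intro conjI exI[of _ K]) (use r0 assms pos in \<open>auto simp: r_def\<close>)
qed

text \<open>Along the segment from \<open>x\<close> to \<open>y\<close>, which stays in the ball,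
  \<open>N \<bullet> (y - x)\<close> has positive derivative and so cannot vanish at both
  ends.\<close>

lemma zero_unique_if_strongly_monotone:
  assumes ball: "ball p r \<subseteq> {x. 0 < B x}"
    and pos: "\<And>x v. x \<in> ball p r \<Longrightarrow> v \<noteq> 0 \<Longrightarrow> 0 < v \<bullet> DN k x v"
    and "x \<in> ball p r" "y \<in> ball p r" "N k x = 0" "N k y = 0"
  shows "x = y"
proof (rule ccontr)
  assume "x \<noteq> y"
  let ?v = "y - x"
  have seg: "x + s *\<^sub>R ?v \<in> ball p r" if "0 \<le> s" "s \<le> 1" for s
  proof -
    have "(1 - s) *\<^sub>R x + s *\<^sub>R y \<in> ball p r"
      using convexD_alt[OF convex_ball assms(3,4) that] .
    then show ?thesis by (simp add: algebra_simps)
  qed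
  have der: "((\<lambda>s. N k (x + s *\<^sub>R ?v) \<bullet> ?v) has_real_derivative ?v \<bullet> DN k (x + s *\<^sub>R ?v) ?v) (at s)"
    if "0 \<le> s" "s \<le> 1" for s
  proof -
    have B0: "0 < B (x + s *\<^sub>R ?v)" using seg[OF that] ball by auto
    then have "x + s *\<^sub>R ?v \<in> F" by (simp add: F_iff)
    from N_has_derivative[OF this, of k] linear_DN[OF this, of k] B0
    have N: "(N k has_derivative DN k (x + s *\<^sub>R ?v)) (at (x + s *\<^sub>R ?v))"
      and lin: "linear (DN k (x + s *\<^sub>R ?v))" by (auto simp: at_F)
    have "((\<lambda>s. x + s *\<^sub>R ?v) has_derivative (\<lambda>s. s *\<^sub>R ?v)) (at s)"
      by (auto intro!: derivative_eq_intros)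
    from has_derivative_inner_left[OF has_derivative_compose[OF this N], of ?v]
    show ?thesis
      by (simp add: has_field_derivative_def linear_scale[OF lin] mult_commute_abs inner_commute)
  qed
  obtain s where "0 < s" "s < 1"
    "N k (x + 1 *\<^sub>R ?v) \<bullet> ?v - N k (x + 0 *\<^sub>R ?v) \<bullet> ?v = (1 - 0) * (?v \<bullet> DN k (x + s *\<^sub>R ?v) ?v)"
    using MVT2[of 0 1, OF _ der] by auto
  then show False using assms(5,6) pos[OF seg[of s], of ?v] \<open>x \<noteq> y\<close> by simp
qed

section \<open>Boundary conditions extended to a layer by compactness\<close>

lemma curvature_gap:
  "\<exists>d>0. \<forall>x v. x \<in> F \<and> B x < d \<and> norm v = 1 \<and> GB x \<bullet> v = 0 \<and> 0 \<le> GB x \<bullet> (x - p) \<longrightarrow>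
    L / l * (GB x \<bullet> (x - p)) < (norm (x - p))\<^sup>2 * (v \<bullet> (HB x *v v))"
proof -
  define D where "D = F \<times> sphere (0::real^'n) 1"
  have cD: "compact D" unfolding D_def by (rule compact_Times[OF compact_F compact_sphere])
  have c1: "continuous_on D (\<lambda>z. snd z \<bullet> (HB (fst z) *v snd z))"
    unfolding D_def by (rule continuous_on_HB_form)
  have cG: "continuous_on D (\<lambda>z. GB (fst z))" unfolding D_def
    by (intro continuous_on_compose2[OF cont_GB] continuous_on_fst continuous_on_id) auto
  have cB: "continuous_on D (\<lambda>z. B (fst z))" unfolding D_def
    by (intro continuous_on_compose2[OF cont_B] continuous_on_fst continuous_on_id) auto
  \<comment> \<open>The pairs \<open>(x, v)\<close> that violate the inequality form a compact set.
    The boundary assumption keeps \<open>B\<close> positive on it, so \<open>B\<close> has a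
    positive lower bound there, and below that bound no violation is possible.\<close>
  define C where "C = {z \<in> D. GB (fst z) \<bullet> snd z = 0} \<inter> {z \<in> D. 0 \<le> GB (fst z) \<bullet> (fst z - p)} \<inter>
    {z \<in> D. (norm (fst z - p))\<^sup>2 * (snd z \<bullet> (HB (fst z) *v snd z)) \<le> L / l * (GB (fst z) \<bullet> (fst z - p))}"
  have "closed {z \<in> D. GB (fst z) \<bullet> snd z = 0}"
    by (intro continuous_closed_preimage_constant compact_imp_closed[OF cD] continuous_intros cG)
  moreover have "closed {z \<in> D. 0 \<le> GB (fst z) \<bullet> (fst z - p)}"
    by (intro continuous_on_closed_Collect_le compact_imp_closed[OF cD] continuous_intros cG)
  moreover have "closed {z \<in> D. (norm (fst z - p))\<^sup>2 * (snd z \<bullet> (HB (fst z) *v snd z)) \<le> L / l * (GB (fst z) \<bullet> (fst z - p))}"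
    by (intro continuous_on_closed_Collect_le compact_imp_closed[OF cD] continuous_intros cG c1)
  ultimately have "closed C" unfolding C_def by (intro closed_Int)
  then have "compact C" using compact_Int_closed[OF cD, of C] by (simp add: C_def Int_absorb1 subset_eq Int_def conj_ac)
  moreover have "continuous_on C (\<lambda>z. B (fst z))"
    using cB by (rule continuous_on_subset) (auto simp: C_def)
  moreover have "0 < B (fst z)" if "z \<in> C" for z
    using that boundary_curvature[of "fst z" "snd z"] by (force simp: C_def D_def F_iff)
  ultimately obtain d where "d > 0" "\<forall>z\<in>C. d \<le> B (fst z)" using compact_pos_lower_bound by blast
  then have "L / l * (GB x \<bullet> (x - p)) < (norm (x - p))\<^sup>2 * (v \<bullet> (HB x *v v))"
    if "x \<in> F" "B x < d" "norm v = 1" "GB x \<bullet> v = 0" "0 \<le> GB x \<bullet> (x - p)" for x v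
    using that by (force simp: C_def D_def)
  then show ?thesis using \<open>d > 0\<close> by blast
qed

text \<open>In dimension one the curvature condition is vacuous, because a nonzero
  \<open>GB x\<close> leaves no unit vector orthogonal to it. This sign takes its place: at critical
  points away from \<open>p\<close> the same product is nonnegative.\<close>

lemma dim_1_gap:
  assumes "CARD('n) = 1"
  shows "\<exists>d>0. \<forall>x\<in>F. B x < d \<longrightarrow> GB x \<bullet> (x - p) < 0"
proof -
  define C where "C = {x \<in> F. 0 \<le> GB x \<bullet> (x - p)}"
  have "closed C" unfolding C_def
    by (intro continuous_on_closed_Collect_le compact_imp_closed[OF compact_F] continuous_intros cont_GB)
  then have "compact C" using compact_Int_closed[OF compact_F, of C] by (simp add: C_def Int_def conj_ac)
  moreover have "continuous_on C B"
    using cont_B by (rule continuous_on_subset) (auto simp: C_def)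
  moreover have "0 < B x" if "x \<in> C" for x
    using that boundary_dim_1[OF assms, of x] by (force simp: C_def F_iff)
  ultimately obtain d where "d > 0" "\<forall>x\<in>C. d \<le> B x" using compact_pos_lower_bound by blast
  then show ?thesis by (force simp: C_def)
qed

text \<open>\<open>B\<close> and \<open>GB\<close> never vanish together on \<open>F\<close>, so
  \<open>B x + norm (GB x)\<close> has a positive lower bound; half of it serves for each
  summand.\<close>

lemma gradient_gap: "\<exists>d>0. \<forall>x\<in>F. B x < d \<longrightarrow> d \<le> norm (GB x)"
proof -
  have "0 < B x + norm (GB x)" if "x \<in> F" for x
    using that boundary_regular[of x] by (cases "B x = 0") (auto simp: F_iff add_pos_nonneg)
  then obtain d where "d > 0" "\<forall>x\<in>F. d \<le> B x + norm (GB x)"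
    using compact_pos_lower_bound[OF compact_F, of "\<lambda>x. B x + norm (GB x)"]
      continuous_on_add[OF cont_B continuous_on_norm[OF cont_GB]] by blast
  then show ?thesis by (intro exI[of _ "d / 2"]) force
qed

lemma critical_far_from_minimizer:
  assumes r: "0 < r"
  shows "\<exists>K. \<forall>k>K. \<forall>x. 0 < B x \<and> r \<le> norm (x - p) \<and> N k x = 0 \<longrightarrow>
    (\<forall>v. DN k x v = 0 \<longrightarrow> v = 0) \<and> (\<exists>v. v \<bullet> DN k x v < 0)"
proof -
  obtain M where M: "M > 0" "\<And>x. x \<in> F \<Longrightarrow> f x \<le> M" "\<And>x. x \<in> F \<Longrightarrow> norm (Gf x) \<le> M"
    "\<And>x. x \<in> F \<Longrightarrow> norm (GB x) \<le> M" "\<And>x v. x \<in> F \<Longrightarrow> \<bar>v \<bullet> (HB x *v v)\<bar> \<le> M * (norm v)\<^sup>2"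
    using uniform_bound by auto
  obtain d1 where d1: "d1 > 0" "\<And>x v. \<lbrakk>x \<in> F; B x < d1; norm v = 1; GB x \<bullet> v = 0; 0 \<le> GB x \<bullet> (x - p)\<rbrakk> \<Longrightarrow>
      L / l * (GB x \<bullet> (x - p)) < (norm (x - p))\<^sup>2 * (v \<bullet> (HB x *v v))"
    using curvature_gap by blast
  obtain d2 where d2: "d2 > 0" "\<And>x. x \<in> F \<Longrightarrow> B x < d2 \<Longrightarrow> d2 \<le> norm (GB x)"
    using gradient_gap by blast
  obtain d3 where d3: "d3 > 0"
    "\<And>x. CARD('n) = 1 \<Longrightarrow> x \<in> F \<Longrightarrow> B x < d3 \<Longrightarrow> GB x \<bullet> (x - p) < 0"
    using dim_1_gap by (metis zero_less_one)
  define d where "d = min d1 (min d2 d3)"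
  have d: "d > 0" "d \<le> d1" "d \<le> d2" "d \<le> d3" using d1(1) d2(1) d3(1) by (auto simp: d_def)
  \<comment> \<open>The first quotient turns \<open>k * (B x * (l * r)) \<le> M\<^sup>2\<close> into
    \<open>B x < d\<close>. The second makes the form positive along \<open>Gf x\<close>; its
    \<open>k - 1\<close> arises because the two mixed terms of \<open>inner_DN\<close> combine with
    the factor \<open>1 - 1 / k\<close>.\<close>
  define K where "K = max 1 (max (M\<^sup>2 / (d * (l * r))) (1 + M\<^sup>2 / (d2 * (l * r))))"
  show ?thesis
  proof (rule exI[of _ K], intro allI impI)
    fix k x assume k: "K < k" and x: "0 < B x \<and> r \<le> norm (x - p) \<and> N k x = 0"
    then have Bx: "0 < B x" and rx: "r \<le> norm (x - p)" and N0: "N k x = 0" and xF: "x \<in> F" and xp: "x \<noteq> p"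
      using r by (auto simp: F_iff)
    have k1: "k > 1" and k2: "M\<^sup>2 / (d * (l * r)) < k" and k3: "M\<^sup>2 / (d2 * (l * r)) < k - 1"
      using k by (auto simp: K_def)
    have fx: "f x > 0" using f_pos[OF xF xp] .
    define s where "s = k * B x / f x"
    have s: "s > 0" using k1 Bx fx by (simp add: s_def)
    have GB: "GB x = s *\<^sub>R Gf x"
    proof -
      have "(k / f x) *\<^sub>R (B x *\<^sub>R Gf x) = (k / f x) *\<^sub>R ((f x / k) *\<^sub>R GB x)"
        using N0 by (simp add: N_def)
      then show ?thesis using fx k1 by (simp add: s_def)
    qed
    have G1: "l * (norm (x - p))\<^sup>2 \<le> Gf x \<bullet> (x - p)" by (rule Gf_mono[OF Bx])
    have nxp: "0 < norm (x - p)" using xp by simp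
    have "l * norm (x - p) * norm (x - p) \<le> norm (Gf x) * norm (x - p)"
      using G1 norm_cauchy_schwarz[of "Gf x" "x - p"] by (simp add: power2_eq_square mult.assoc)
    then have "l * norm (x - p) \<le> norm (Gf x)" using nxp by simp
    moreover have "l * r \<le> l * norm (x - p)" using rx l_pos by simp
    ultimately have Gf_ge: "l * r \<le> norm (Gf x)" by simp
    have lr: "0 < l * r" using l_pos r by simp
    have "k * B x * (l * r) \<le> k * B x * norm (Gf x)"
      using Gf_ge k1 Bx by (intro mult_left_mono) auto
    also have "\<dots> = f x * norm (GB x)" using GB fx k1 Bx by (simp add: s_def abs_mult)
    also have "\<dots> \<le> M\<^sup>2"
      unfolding power2_eq_square using M(2,4)[OF xF] M(1) by (intro mult_mono) auto
    finally have kB: "k * (B x * (l * r)) \<le> M\<^sup>2" by (simp add: mult.assoc)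
    have "B x < d"
    proof (rule ccontr)
      assume "\<not> B x < d"
      then have "k * (d * (l * r)) \<le> k * (B x * (l * r))"
        using lr k1 by (intro mult_left_mono mult_right_mono) auto
      moreover have "M\<^sup>2 < k * (d * (l * r))"
        using k2 d(1) lr by (simp add: pos_divide_less_eq)
      ultimately show False using kB by linarith
    qed
    then have Bd: "B x < d1" "B x < d2" "B x < d3" using d by auto
    have Gf_nz: "Gf x \<noteq> 0" using Gf_ge lr by auto
    \<comment> \<open>This sign, forced by \<open>GB x = s *\<^sub>R Gf x\<close> with
      \<open>s > 0\<close>, opens the way to \<open>curvature_gap\<close> and later contradicts
      \<open>dim_1_gap\<close>.\<close>
    have GBxp: "0 \<le> GB x \<bullet> (x - p)"
      using G1 s l_pos by (simp add: GB) (meson less_imp_le mult_nonneg_nonneg order_trans zero_le_power2)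
    have neg1: "v \<bullet> DN k x v < 0" if v: "norm v = 1" "v \<bullet> Gf x = 0" for v
    proof -
      have gap: "L / l * (GB x \<bullet> (x - p)) < (norm (x - p))\<^sup>2 * (v \<bullet> (HB x *v v))"
        using v by (intro d1(2)[OF xF Bd(1) v(1) _ GBxp]) (simp add: GB inner_commute)
      have "s * (l * (norm (x - p))\<^sup>2) \<le> GB x \<bullet> (x - p)"
        using G1 s by (simp add: GB)
      then have "L / l * (s * (l * (norm (x - p))\<^sup>2)) \<le> L / l * (GB x \<bullet> (x - p))"
        using l_pos l_le_L by (intro mult_left_mono) auto
      then have "(norm (x - p))\<^sup>2 * (s * L) < (norm (x - p))\<^sup>2 * (v \<bullet> (HB x *v v))"
        using gap l_pos by (simp add: mult_ac)
      then have "s * L < v \<bullet> (HB x *v v)" using nxp by simp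
      then have "f x / k * (s * L) < f x / k * (v \<bullet> (HB x *v v))"
        by (rule mult_strict_left_mono) (use fx k1 in auto)
      moreover have "f x / k * (s * L) = B x * L" using fx k1 by (simp add: s_def)
      moreover have "B x * (v \<bullet> (Hf x *v v)) \<le> B x * L"
        using Hf_le[OF Bx, of v] v(1) Bx by simp
      ultimately show ?thesis using v(2) by (simp add: inner_DN GB inner_commute)
    qed
    have neg: "v \<bullet> DN k x v < 0" if v: "v \<bullet> Gf x = 0" "v \<noteq> 0" for v
    proof -
      have "((1 / norm v) *\<^sub>R v) \<bullet> DN k x ((1 / norm v) *\<^sub>R v) < 0" using v by (intro neg1) auto
      then show ?thesis using v(2)
        by (simp add: linear_scale[OF linear_DN[OF xF]] divide_less_0_iff)
    qed
    \<comment> \<open>Along \<open>Gf x\<close> the mixed terms contribute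
      \<open>(1 - 1 / k) * s\<close> times the fourth power of the norm of \<open>Gf x\<close>.
      Since \<open>s * (norm (Gf x))\<^sup>2\<close> is the product of the two gradient norms, it is
      bounded below near the boundary, while the term with \<open>HB\<close> carries
      \<open>1 / k\<close>.\<close>
    have pos: "0 < Gf x \<bullet> DN k x (Gf x)"
    proof -
      let ?n = "(norm (Gf x))\<^sup>2"
      have n: "?n > 0" using Gf_nz by simp
      have "M\<^sup>2 < (k - 1) * (d2 * (l * r))" using k3 d2(1) lr by (simp add: pos_divide_less_eq)
      also have "\<dots> \<le> (k - 1) * (norm (GB x) * norm (Gf x))"
        using d2(2)[OF xF Bd(2)] Gf_ge lr d2(1) k1 by (intro mult_left_mono mult_mono) auto
      also have "norm (GB x) * norm (Gf x) = s * ?n" using s by (simp add: GB power2_eq_square)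
      finally have big: "M\<^sup>2 * ?n < (k - 1) * (s * ?n) * ?n" using n by (intro mult_strict_right_mono) auto
      have "f x * (Gf x \<bullet> (HB x *v Gf x)) \<le> M * (M * ?n)"
        using M(5)[OF xF, of "Gf x"] M(1) M(2)[OF xF] fx
        by (meson abs_ge_self less_imp_le mult_left_mono mult_right_mono order_trans mult_nonneg_nonneg zero_le_power2)
      then have H: "f x * (Gf x \<bullet> (HB x *v Gf x)) \<le> M\<^sup>2 * ?n" by (simp add: power2_eq_square mult.assoc)
      have Hfn: "0 \<le> B x * (Gf x \<bullet> (Hf x *v Gf x))"
        using Hf_ge[OF Bx, of "Gf x"] l_pos Bx
        by (meson less_imp_le mult_nonneg_nonneg order_trans zero_le_power2)
      have "k * (Gf x \<bullet> DN k x (Gf x)) = (k - 1) * (s * ?n) * ?n + k * (B x * (Gf x \<bullet> (Hf x *v Gf x)))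
          - f x * (Gf x \<bullet> (HB x *v Gf x))"
        using k1 by (simp add: inner_DN GB power2_norm_eq_inner field_simps)
      also have "\<dots> > 0" using big H mult_nonneg_nonneg[OF _ Hfn, of k] k1 by linarith
      finally show ?thesis using k1 by (simp add: zero_less_mult_iff)
    qed
    \<comment> \<open>The mixed terms of \<open>DN\<close> are not symmetric in general; they become
      so here because \<open>GB x\<close> and \<open>Gf x\<close> are parallel.\<close>
    have sym: "u \<bullet> DN k x v = v \<bullet> DN k x u" for u v
      using Hf_sym[OF Bx, of u v] HB_sym[of u x v]
      by (simp add: DN_def GB inner_diff_right inner_add_right inner_commute mult_ac)
    have "\<exists>v. v \<noteq> 0 \<and> v \<bullet> Gf x = 0"
    proof -
      have "CARD('n) \<noteq> 1" using d3(2)[OF _ xF Bd(3)] GBxp by force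
      moreover have "CARD('n) > 0" by (simp add: card_gt_0_iff)
      ultimately have "2 \<le> CARD('n)" by linarith
      then have "2 \<le> DIM(real^'n)" by simp
      then obtain v where "v \<noteq> 0" "orthogonal (Gf x) v" by (rule orthogonal_to_vector_exists)
      then show ?thesis by (auto simp: orthogonal_def inner_commute)
    qed
    then show "(\<forall>v. DN k x v = 0 \<longrightarrow> v = 0) \<and> (\<exists>v. v \<bullet> DN k x v < 0)"
      using nondegenerate_if_opposite_signs[OF linear_DN[OF xF] sym pos neg] neg by blast
  qed
qed

section \<open>Navigation function for the abstract potential\<close>

theorem navigation_function_phi:
  assumes "0 < e"
  shows "\<exists>K. \<forall>k>K. \<exists>q. navigation_function F (phi k) q \<and> norm (q - p) < e \<and>
    (f p = 0 \<or> GB p = 0 \<longrightarrow> q = p)"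
proof -
  obtain r K1 where r: "r > 0" "r \<le> e" "ball p r \<subseteq> {x. 0 < B x}"
    and near: "\<And>k x v. k > K1 \<Longrightarrow> x \<in> ball p r \<Longrightarrow> v \<noteq> 0 \<Longrightarrow> 0 < v \<bullet> DN k x v"
    using strongly_monotone_near_minimizer[OF assms] by blast
  obtain K2 where far: "\<And>k x. \<lbrakk>k > K2; 0 < B x; r \<le> norm (x - p); N k x = 0\<rbrakk> \<Longrightarrow>
    (\<forall>v. DN k x v = 0 \<longrightarrow> v = 0) \<and> (\<exists>v. v \<bullet> DN k x v < 0)"
    using critical_far_from_minimizer[OF r(1)] by blast
  show ?thesis
  \<comment> \<open>\<open>2\<close> is the threshold for twice continuous differentiability;
    \<open>K1\<close> governs the ball around \<open>p\<close> and \<open>K2\<close> its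
    complement.\<close>
  proof (rule exI[of _ "max 2 (max K1 K2)"], intro allI impI)
    fix k assume "max 2 (max K1 K2) < k"
    then have k: "k > 2" "k > K1" "k > K2" "k > 1" by auto
    have in_ball: "x \<in> ball p r \<longleftrightarrow> \<not> r \<le> norm (x - p)" for x
      by (auto simp: dist_norm norm_minus_commute)
    have "continuous_on F (phi k)"
      unfolding continuous_on_eq_continuous_within
      using phi_has_derivative[OF _ k(4)] has_derivative_continuous by blast
    then obtain q where q: "q \<in> F" "\<And>y. y \<in> F \<Longrightarrow> phi k q \<le> phi k y"
      using continuous_attains_inf[OF compact_F] p_in_F by blast
    have q_min: "local_min_on F (phi k) q"
      using q unfolding local_min_on_def by (auto intro: exI[of _ 1])
    have min_in_ball: "x \<in> ball p r" if "local_min_on F (phi k) x" for x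
      using far[OF k(3) local_min_imp_interior[OF that k(4)] _ local_min_imp_N[OF that k(4)]]
        local_min_imp_DN[OF that k(4)] unfolding in_ball by (meson not_le)
    have unique: "x = y" if "x \<in> ball p r" "y \<in> ball p r" "N k x = 0" "N k y = 0" for x y
      using zero_unique_if_strongly_monotone[OF r(3) near[OF k(2)] that] .
    have mins: "local_min_on F (phi k) x \<longleftrightarrow> x = q" for x
      using q_min unique min_in_ball local_min_imp_N k(4) by blast
    have nondeg: "invertible (hessian_on F (phi k) x)" if x: "x \<in> F" "grad_on F (phi k) x = 0" for x
    proof -
      have Bx: "0 < B x"
        using x grad_phi_boundary[OF _ k(4), of x] by (fastforce simp: F_iff)
      have N0: "N k x = 0"
        using x grad_phi[OF Bx k(4)] weight_pos[OF x(1), of k] by simp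
      show ?thesis
      proof (rule hessian_phi_invertible[OF Bx k(4) N0])
        fix v assume "DN k x v = 0"
        then show "v = 0"
          using near[OF k(2), of x v] far[OF k(3) Bx _ N0] unfolding in_ball by force
      qed
    qed
    have "phi k ` F \<subseteq> {0..1}"
      using phi_nonneg phi_boundary[OF _ k(4)] phi_interior[OF _ k(4)]
      by (force simp: F_iff le_less)
    moreover have "frontier F = {x \<in> F. phi k x = 1}"
    proof -
      have "frontier F = F - {x. 0 < B x}"
        using compact_imp_closed[OF compact_F] by (simp add: frontier_def interior_F)
      also have "\<dots> = {x \<in> F. phi k x = 1}"
        using phi_boundary[OF _ k(4)] phi_interior[OF _ k(4)] by (force simp: F_iff)
      finally show ?thesis .
    qed
    moreover have "q \<in> interior F"
      using local_min_imp_interior[OF q_min k(4)] by (rule int_F)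
    ultimately have "navigation_function F (phi k) q"
      unfolding navigation_function_def using Ck_phi[OF k(1)] mins nondeg by blast
    moreover have "norm (q - p) < e"
      using min_in_ball[OF q_min] r(2) unfolding in_ball by linarith
    \<comment> \<open>As \<open>Gf p = 0\<close>, \<open>N k p\<close> reduces to a multiple of
      \<open>f p *\<^sub>R GB p\<close>. If either factor vanishes, \<open>p\<close> is a zero of
      \<open>N\<close> in the ball, where zeros are unique.\<close>
    moreover have "q = p" if "f p = 0 \<or> GB p = 0"
    proof (rule unique[OF min_in_ball[OF q_min] _ local_min_imp_N[OF q_min k(4)]])
      show "p \<in> ball p r" using r(1) by simp
      show "N k p = 0" using that by (auto simp: N_def Gf_p)
    qed
    ultimately show "\<exists>q. navigation_function F (phi k) q \<and> norm (q - p) < e \<and> (f p = 0 \<or> GB p = 0 \<longrightarrow> q = p)"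
      by blast
  qed
qed

end

subsection \<open>Convex obstacles\<close>

text \<open>Otherwise \<open>g\<close> minus its chord, taken along the segment, would have positive
  slope at \<open>0\<close>, and \<open>g\<close> would rise above the chord.\<close>

lemma convex_on_above_tangent:
  fixes g :: "'a::real_inner \<Rightarrow> real"
  assumes conv: "convex_on UNIV g" and der: "(g has_derivative (\<lambda>h. G \<bullet> h)) (at x)"
  shows "G \<bullet> (y - x) \<le> g y - g x"
proof (rule ccontr)
  assume neg: "\<not> ?thesis"
  have "((\<lambda>s. g (x + s *\<^sub>R (y - x))) has_real_derivative G \<bullet> (y - x)) (at 0)"
    using has_real_derivative_along_line[of g G x 0 "y - x"] der by simp
  then have "((\<lambda>s. g (x + s *\<^sub>R (y - x)) - s * (g y - g x)) has_real_derivative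
      G \<bullet> (y - x) - (g y - g x)) (at 0)"
    by (auto intro!: derivative_eq_intros)
  from DERIV_pos_inc_right[OF this] neg
  obtain d where d: "d > 0" "\<And>s. 0 < s \<Longrightarrow> s < d \<Longrightarrow> g x < g (x + s *\<^sub>R (y - x)) - s * (g y - g x)"
    by auto
  define s where "s = min d 1 / 2"
  have s: "0 < s" "s < d" "s < 1" using d(1) by (auto simp: s_def)
  have "g ((1 - s) *\<^sub>R x + s *\<^sub>R y) \<le> (1 - s) * g x + s * g y"
    using s by (intro convex_onD[OF conv]) auto
  then show False using d(2)[OF s(1,2)] by (simp add: algebra_simps)
qed

text \<open>The formulas serve at a zero of \<open>f\<close>, with \<open>f\<close> one of the
  \<open>\<beta> i\<close> and \<open>g\<close> the product of the others: only the terms with the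
  factor \<open>g x\<close> survive, and the cross term drops for \<open>v\<close> orthogonal to
  \<open>Gf x\<close>.\<close>

lemma
  assumes f: "gradient_hessian_on UNIV f Gf Hf" and g: "gradient_hessian_on UNIV g Gg Hg"
    and h: "gradient_hessian_on UNIV h Gh Hh" and h_eq: "\<And>x. h x = f x * g x"
  shows gradient_mult: "Gh x = f x *\<^sub>R Gg x + g x *\<^sub>R Gf x"
    and hessian_form_mult: "v \<bullet> (Hh x *v v) =
      f x * (v \<bullet> (Hg x *v v)) + g x * (v \<bullet> (Hf x *v v)) + 2 * (Gf x \<bullet> v) * (Gg x \<bullet> v)"
proof -
  have D1: "(f has_derivative (\<lambda>h. Gf x \<bullet> h)) (at x)" "(g has_derivative (\<lambda>h. Gg x \<bullet> h)) (at x)"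
    "(h has_derivative (\<lambda>v. Gh x \<bullet> v)) (at x)" for x
    using gradient_hessian_onD1[OF f, of x] gradient_hessian_onD1[OF g, of x]
      gradient_hessian_onD1[OF h, of x] by simp_all
  have D2: "(Gf has_derivative (\<lambda>v. Hf x *v v)) (at x)" "(Gg has_derivative (\<lambda>v. Hg x *v v)) (at x)"
    "(Gh has_derivative (\<lambda>v. Hh x *v v)) (at x)"
    using gradient_hessian_onD2[OF f, of x] gradient_hessian_onD2[OF g, of x]
      gradient_hessian_onD2[OF h, of x] by simp_all
  have Gh: "Gh x = f x *\<^sub>R Gg x + g x *\<^sub>R Gf x" for x
  proof -
    have "(h has_derivative (\<lambda>v. f x * (Gg x \<bullet> v) + (Gf x \<bullet> v) * g x)) (at x)"
      using has_derivative_mult[OF D1(1,2)[of x]] by (simp add: h_eq[abs_def])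
    from has_derivative_unique[OF D1(3) this]
    have "Gh x \<bullet> v = (f x *\<^sub>R Gg x + g x *\<^sub>R Gf x) \<bullet> v" for v
      by (metis (no_types) inner_add_left inner_scaleR_left mult.commute)
    then show ?thesis using vector_eq_rdot by blast
  qed
  then show "Gh x = f x *\<^sub>R Gg x + g x *\<^sub>R Gf x" .
  have "(Gh has_derivative (\<lambda>v. (f x *\<^sub>R (Hg x *v v) + (Gf x \<bullet> v) *\<^sub>R Gg x) +
      (g x *\<^sub>R (Hf x *v v) + (Gg x \<bullet> v) *\<^sub>R Gf x))) (at x)"
    unfolding Gh[abs_def] by (intro has_derivative_add has_derivative_scaleR D1 D2)
  from has_derivative_unique[OF D2(3) this]
  have "Hh x *v v = (f x *\<^sub>R (Hg x *v v) + (Gf x \<bullet> v) *\<^sub>R Gg x) +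
      (g x *\<^sub>R (Hf x *v v) + (Gg x \<bullet> v) *\<^sub>R Gf x)" by (rule fun_cong)
  then show "v \<bullet> (Hh x *v v) =
      f x * (v \<bullet> (Hg x *v v)) + g x * (v \<bullet> (Hf x *v v)) + 2 * (Gf x \<bullet> v) * (Gg x \<bullet> v)"
    by (simp add: inner_add_right inner_commute algebra_simps)
qed

text \<open>If \<open>x\<close> were as low as \<open>p\<close>, their midpoint would lie lower by
  at least \<open>c * (norm (x - p))\<^sup>2 / 8\<close>.\<close>

lemma strongly_convex_on_strict_min:
  assumes "strongly_convex_on X f" "is_arg_min f (\<lambda>x. x \<in> X) p" "x \<in> X" "x \<noteq> p"
  shows "f p < f x"
proof (rule ccontr)
  assume "\<not> f p < f x"
  obtain c where c: "c > 0" "convex_on X (\<lambda>x. f x - c / 2 * (norm x)\<^sup>2)"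
    using assms(1) by (auto simp: strongly_convex_on_def)
  have p: "p \<in> X" "\<And>y. y \<in> X \<Longrightarrow> f p \<le> f y"
    using assms(2) by (auto simp: is_arg_min_linorder)
  define y where "y = (1 / 2) *\<^sub>R x + (1 / 2) *\<^sub>R p"
  have "y \<in> X"
    unfolding y_def using convex_on_imp_convex[OF c(2)] assms(3) p(1) by (intro convexD) auto
  have "f y - c / 2 * (norm y)\<^sup>2 \<le>
      (1 - 1 / 2) * (f x - c / 2 * (norm x)\<^sup>2) + 1 / 2 * (f p - c / 2 * (norm p)\<^sup>2)"
    using convex_onD[OF c(2), of "1 / 2" x p] assms(3) p(1) by (simp add: y_def)
  moreover have "(norm y)\<^sup>2 = (norm x)\<^sup>2 / 2 + (norm p)\<^sup>2 / 2 - (norm (x - p))\<^sup>2 / 4"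
    by (simp add: y_def power2_norm_eq_inner inner_add_left inner_add_right inner_diff_left
        inner_diff_right inner_commute field_simps)
  ultimately have "f y \<le> f x / 2 + f p / 2 - c * (norm (x - p))\<^sup>2 / 8"
    by (simp add: field_simps)
  moreover have "c * (norm (x - p))\<^sup>2 / 8 > 0" using c(1) assms(4) by simp
  ultimately show False using \<open>\<not> f p < f x\<close> p(2)[OF \<open>y \<in> X\<close>] by linarith
qed

lemma inner_nonzero_dim_1:
  fixes u v :: "real^'n"
  assumes "CARD('n) = 1" "u \<noteq> 0" "v \<noteq> 0"
  shows "u \<bullet> v \<noteq> 0"
proof -
  obtain a where a: "(UNIV :: 'n set) = {a}" using assms(1) card_1_singletonE by blast
  then have "u $ a \<noteq> 0" "v $ a \<noteq> 0"
    using assms(2,3) by (metis (mono_tags) UNIV_I singletonD vec_eq_iff zero_index)+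
  then show ?thesis by (simp add: inner_vec_def a)
qed

text \<open>By convexity a step from \<open>x\<close> towards \<open>y\<close> enters the strict
  sublevel set at once, even if \<open>g x = 0\<close>. Hence zeros of \<open>\<beta> i\<close> are
  limits of points of the obstacle.\<close>

lemma sublevel_accumulates:
  fixes g :: "'a::real_normed_vector \<Rightarrow> real"
  assumes "convex_on UNIV g" "g x \<le> 0" "g y < 0" "open U" "x \<in> U"
  shows "\<exists>z\<in>U. g z < 0"
proof -
  obtain d where d: "d > 0" "\<And>s. \<bar>s\<bar> < d \<Longrightarrow> x + s *\<^sub>R (y - x) \<in> U"
    using open_contains_segment_germ[OF assms(4,5), of "y - x"] by auto
  define s where "s = min d 1 / 2"
  have s: "0 < s" "\<bar>s\<bar> < d" "s < 1" using d(1) by (auto simp: s_def)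
  have "g ((1 - s) *\<^sub>R x + s *\<^sub>R y) \<le> (1 - s) * g x + s * g y"
    using s by (intro convex_onD[OF assms(1)]) auto
  also have "\<dots> < 0"
    using s assms(2,3) by (intro add_nonpos_neg mult_nonneg_nonpos mult_pos_neg) auto
  finally have "g (x + s *\<^sub>R (y - x)) < 0" by (simp add: algebra_simps)
  then show ?thesis using d(2)[OF s(2)] by blast
qed

theorem theorem2:
  fixes X :: "(real ^ 'n) set"
    and Obs :: "nat \<Rightarrow> (real ^ 'n) set"
    and m :: nat
    and \<beta> :: "nat \<Rightarrow> real ^ 'n \<Rightarrow> real"
    and f0 :: "real ^ 'n \<Rightarrow> real"
    and xstar :: "real ^ 'n"
    and lmin lmax :: real
    and mumin mumax :: "nat \<Rightarrow> real"
  assumes X: "X \<noteq> {}" "compact X" "convex X"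
    and Obs: "\<And>i. i \<in> {1..m} \<Longrightarrow> Obs i \<subseteq> X \<and> open (Obs i) \<and> convex (Obs i) \<and>
               interior (Obs i) \<noteq> {} \<and> has_smooth_boundary (Obs i)"
    and beta0: "Ck_on 2 UNIV (\<beta> 0)" "concave_on UNIV (\<beta> 0)"
               "X = {x. 0 \<le> \<beta> 0 x}" "frontier X = {x. \<beta> 0 x = 0}"
    and betai: "\<And>i. i \<in> {1..m} \<Longrightarrow> Ck_on 2 UNIV (\<beta> i) \<and> convex_on UNIV (\<beta> i) \<and>
               Obs i = {x. \<beta> i x < 0}"
    and separated: "\<And>x i j. \<lbrakk>i \<le> m; \<beta> i x \<le> 0; j \<le> m; j \<noteq> i\<rbrakk> \<Longrightarrow> \<beta> j x > 0"
    and f0: "\<And>x. x \<in> X \<Longrightarrow> 0 \<le> f0 x" "Ck_on 2 X f0" "strongly_convex_on X f0"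
    and lambda: "0 < lmin" "\<And>x. x \<in> X \<Longrightarrow> eigenvalues (hessian_on X f0 x) \<subseteq> {lmin..lmax}"
    and xstar: "is_arg_min f0 (\<lambda>x. x \<in> X) xstar" "xstar \<in> interior (free_space m \<beta>)"
    and mu: "\<And>i. i \<in> {1..m} \<Longrightarrow> strongly_convex_on X (\<beta> i) \<and> 0 < mumin i \<and>
               (\<forall>x\<in>X. eigenvalues (hessian_on UNIV (\<beta> i) x) \<subseteq> {mumin i..mumax i})"
    and manifold: "compact (free_space m \<beta>)" "connected (free_space m \<beta>)"
               "analytic_manifold_with_boundary (free_space m \<beta>)"
    and condition: "\<And>i xs. \<lbrakk>i \<in> {1..m}; xs \<in> frontier (Obs i)\<rbrakk> \<Longrightarrow>
               lmax / lmin * ((grad_on UNIV (\<beta> i) xs \<bullet> (xs - xstar)) / (norm (xs - xstar))\<^sup>2)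
                 < mumin i"
  shows "\<forall>\<epsilon>>0. \<exists>K :: real. \<forall>k :: real. 0 < k \<and> K < k \<longrightarrow>
           (\<exists>xbar. navigation_function (free_space m \<beta>) (potential f0 m \<beta> k) xbar \<and>
                   norm (xbar - xstar) < \<epsilon> \<and>
                   (f0 xstar = 0 \<or> grad_on UNIV (beta_prod m \<beta>) xstar = 0 \<longrightarrow> xbar = xstar))"
proof -
  let ?F = "free_space m \<beta>" and ?B = "beta_prod m \<beta>"
  have F_eq: "?F = X - (\<Union>i\<in>{1..m}. Obs i)"
    using separated beta0(3) betai by (intro free_space_eq) blast+
  then have F_X: "?F \<subseteq> X" by blast
  have Ck_beta: "Ck_on 2 UNIV (\<beta> i)" if "i \<le> m" for i
    using that beta0(1) betai[of i] by (cases i) auto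
  have Ck_B: "Ck_on 2 UNIV ?B"
    unfolding beta_prod_def[abs_def] by (intro Ck_on_prod Ck_beta) simp
  obtain GB HB where B: "gradient_hessian_on UNIV ?B GB HB"
    using Ck_on_2_imp_gradient_hessian_on[OF Ck_B] by blast
  obtain Gf Hf where f: "gradient_hessian_on X f0 Gf Hf"
    using Ck_on_2_imp_gradient_hessian_on[OF f0(2)] by blast
  have cont_B: "continuous_on UNIV ?B" by (rule gradient_hessian_on_continuous(1)[OF B])
  have F_iff: "x \<in> ?F \<longleftrightarrow> 0 \<le> ?B x" for x by (simp add: free_space_def)
  have B_zero: "\<exists>i\<le>m. \<beta> i x = 0" if "?B x = 0" for x
    using that by (auto simp: beta_prod_def)

  have Obs_ne: "\<exists>y. \<beta> i y < 0" if "i \<in> {1..m}" for i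
    using Obs[OF that] betai[OF that] interior_subset[of "Obs i"] by blast

  \<comment> \<open>The point is that no zero of the product is interior: a zero of
    \<open>\<beta> 0\<close> lies on the frontier of \<open>X\<close>, and a zero of another factor
    has obstacle points in every neighbourhood.\<close>
  have interior_F: "interior ?F = {x. 0 < ?B x}"
  proof
    have "open {x. 0 < ?B x}" using cont_B by (intro open_Collect_less) auto
    then show "{x. 0 < ?B x} \<subseteq> interior ?F"
      by (rule interior_maximal[rotated]) (auto simp: F_iff)
    show "interior ?F \<subseteq> {x. 0 < ?B x}"
    proof
      fix x assume x: "x \<in> interior ?F"
      then have xF: "x \<in> ?F" using interior_subset by blast
      have "?B x \<noteq> 0"
      proof
        assume "?B x = 0"
        then obtain i where i: "i \<le> m" "\<beta> i x = 0" using B_zero by blast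
        show False
        proof (cases "i = 0")
          case True
          then have "x \<in> frontier X" using i beta0(4) by simp
          then show False using x interior_mono[OF F_X] by (auto simp: frontier_def)
        next
          case False
          then have i': "i \<in> {1..m}" using i by auto
          obtain y where "\<beta> i y < 0" using Obs_ne[OF i'] by blast
          then obtain z where "z \<in> interior ?F" "\<beta> i z < 0"
            using sublevel_accumulates[of "\<beta> i" x y "interior ?F"] betai[OF i'] i x by auto
          then show False using F_eq betai[OF i'] i' interior_subset[of ?F] by blast
        qed
      qed
      then show "x \<in> {x. 0 < ?B x}" using xF by (simp add: F_iff)
    qed
  qed

  have B_p: "0 < ?B xstar" using xstar(2) interior_F by blast
  have p_F: "xstar \<in> ?F" using xstar(2) interior_subset by blast
  have int_X: "x \<in> interior X" if "0 < ?B x" for x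
    using that interior_F interior_mono[OF F_X] by blast
  have beta0_p: "0 < \<beta> 0 xstar"
  proof -
    have "\<beta> 0 xstar \<noteq> 0" using int_X[OF B_p] beta0(4) by (auto simp: frontier_def)
    then show ?thesis using p_F F_X beta0(3) by force
  qed

  have f_at: "(f0 has_derivative (\<lambda>h. Gf x \<bullet> h)) (at x)" "(Gf has_derivative (\<lambda>h. Hf x *v h)) (at x)"
    if "x \<in> interior X" for x
    using gradient_hessian_onD1[OF f, of x] gradient_hessian_onD2[OF f, of x] that
      interior_subset[of X] by (auto simp: at_within_interior[OF that])
  have p_min: "xstar \<in> X" "\<And>x. x \<in> X \<Longrightarrow> f0 xstar \<le> f0 x"
    using xstar(1) by (auto simp: is_arg_min_linorder)
  have Gf_p: "Gf xstar = 0"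
  proof -
    have "(\<lambda>h. Gf xstar \<bullet> h) = (\<lambda>h. 0)"
      using int_X[OF B_p] p_min interior_subset[of X]
      by (intro differential_zero_maxmin[OF _ open_interior[of X] f_at(1)]) auto
    then have "Gf xstar \<bullet> Gf xstar = 0" by metis
    then show ?thesis by simp
  qed
  have Hf_bounds: "lmin * (norm v)\<^sup>2 \<le> v \<bullet> (Hf x *v v)" "v \<bullet> (Hf x *v v) \<le> lmax * (norm v)\<^sup>2"
    if x: "x \<in> interior X" for x v
  proof -
    have "eigenvalues (Hf x) \<subseteq> {lmin..lmax}"
      using lambda(2)[of x] x interior_subset[of X] gradient_hessian_on_hessian[OF f x] by auto
    then show "lmin * (norm v)\<^sup>2 \<le> v \<bullet> (Hf x *v v)" "v \<bullet> (Hf x *v v) \<le> lmax * (norm v)\<^sup>2"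
      using gradient_hessian_on_symmetric[OF f x]
      by (auto intro!: inner_matrix_ge_if_eigenvalues_ge inner_matrix_le_if_eigenvalues_le)
  qed
  \<comment> \<open>A unit vector at \<open>xstar\<close> squeezes the Hessian form between both
    bounds.\<close>
  have l_le_L: "lmin \<le> lmax"
    using order_trans[OF Hf_bounds[OF int_X[OF B_p], of "axis undefined 1"]] by (simp add: norm_axis_1)
  have Gf_mono: "lmin * (norm (x - xstar))\<^sup>2 \<le> Gf x \<bullet> (x - xstar)" if x: "0 < ?B x" for x
  proof -
    let ?v = "x - xstar"
    \<comment> \<open>The segment may cross obstacles, so it is followed in
      \<open>interior X\<close>, which is convex and where the Hessian bounds hold
      throughout.\<close>
    have seg: "xstar + s *\<^sub>R ?v \<in> interior X" if "0 \<le> s" "s \<le> 1" for s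
      using convexD_alt[OF convex_interior[OF X(3)] int_X[OF B_p] int_X[OF x] that]
      by (simp add: algebra_simps)
    have der: "((\<lambda>s. Gf (xstar + s *\<^sub>R ?v) \<bullet> ?v) has_real_derivative ?v \<bullet> (Hf (xstar + s *\<^sub>R ?v) *v ?v)) (at s)"
      if "0 \<le> s" "s \<le> 1" for s
    proof -
      have "((\<lambda>s. xstar + s *\<^sub>R ?v) has_derivative (\<lambda>s. s *\<^sub>R ?v)) (at s)"
        by (auto intro!: derivative_eq_intros)
      from has_derivative_inner_left[OF has_derivative_compose[OF this f_at(2)[OF seg[OF that]]], of ?v]
      show ?thesis
        by (simp add: has_field_derivative_def matrix_vector_mult_scaleR mult_commute_abs inner_commute)
    qed
    obtain s where s: "0 < s" "s < 1"
      "Gf (xstar + 1 *\<^sub>R ?v) \<bullet> ?v - Gf (xstar + 0 *\<^sub>R ?v) \<bullet> ?v = (1 - 0) * (?v \<bullet> (Hf (xstar + s *\<^sub>R ?v) *v ?v))"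
      using MVT2[of 0 1, OF _ der] by auto
    then show ?thesis using Hf_bounds(1)[OF seg[of s], of ?v] Gf_p by simp
  qed

  \<comment> \<open>By separation exactly one factor vanishes at \<open>x\<close>, and
    \<open>c\<close> is the positive product of the others. On the tangent space of the level set
    the Hessian form of the product is then \<open>c\<close> times that of the active
    factor.\<close>
  have boundary: "\<exists>i Gi Hi c. i \<le> m \<and> \<beta> i x = 0 \<and> 0 < c \<and> gradient_hessian_on UNIV (\<beta> i) Gi Hi \<and>
      GB x = c *\<^sub>R Gi x \<and> (\<forall>v. Gi x \<bullet> v = 0 \<longrightarrow> v \<bullet> (HB x *v v) = c * (v \<bullet> (Hi x *v v)))"
    if Bx: "?B x = 0" for x
  proof -
    obtain i where i: "i \<le> m" "\<beta> i x = 0" using B_zero[OF Bx] by blast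
    define g where "g y = (\<Prod>j\<in>{..m} - {i}. \<beta> j y)" for y
    have "Ck_on 2 UNIV g" unfolding g_def[abs_def] by (intro Ck_on_prod Ck_beta) simp
    then obtain Gg Hg where g: "gradient_hessian_on UNIV g Gg Hg"
      using Ck_on_2_imp_gradient_hessian_on by blast
    obtain Gi Hi where Gi: "gradient_hessian_on UNIV (\<beta> i) Gi Hi"
      using Ck_on_2_imp_gradient_hessian_on[OF Ck_beta[OF i(1)]] by blast
    have prod: "?B y = \<beta> i y * g y" for y
      unfolding beta_prod_def g_def using i(1) by (intro prod.remove) auto
    have "0 < g x"
      unfolding g_def using i separated[OF i(1), of x] by (intro prod_pos) auto
    moreover have "GB x = g x *\<^sub>R Gi x" using gradient_mult[OF Gi g B prod, of x] i(2) by simp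
    moreover have "v \<bullet> (HB x *v v) = g x * (v \<bullet> (Hi x *v v))" if "Gi x \<bullet> v = 0" for v
      using hessian_form_mult[OF Gi g B prod, of v x] i(2) that by simp
    ultimately show ?thesis using i Gi by blast
  qed
  \<comment> \<open>The tangent inequality for the convex function \<open>- \<beta> 0\<close>,
    evaluated at \<open>xstar\<close>, where \<open>\<beta> 0\<close> is positive.\<close>
  have outer: "Gi x \<bullet> (x - xstar) < 0" if "\<beta> 0 x = 0" "gradient_hessian_on UNIV (\<beta> 0) Gi Hi" for x Gi Hi
  proof -
    have "((\<lambda>x. - \<beta> 0 x) has_derivative (\<lambda>h. (- Gi x) \<bullet> h)) (at x)"
      using has_derivative_minus[OF gradient_hessian_onD1[OF that(2), of x]] by simp
    from convex_on_above_tangent[OF _ this, of xstar]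
    have "- (Gi x \<bullet> (xstar - x)) \<le> - \<beta> 0 xstar"
      using beta0(2) that(1) by (simp add: concave_on_def)
    then show ?thesis using beta0_p by (simp add: inner_diff_right)
  qed
  have regular: "GB x \<noteq> 0" if Bx: "?B x = 0" for x
  proof -
    obtain i Gi Hi c where i: "i \<le> m" "\<beta> i x = 0" "0 < c" "gradient_hessian_on UNIV (\<beta> i) Gi Hi"
      "GB x = c *\<^sub>R Gi x" using boundary[OF Bx] by blast
    \<comment> \<open>A zero gradient would make \<open>x\<close> a global maximum of
      \<open>\<beta> 0\<close> or a global minimum of a convex \<open>\<beta> i\<close> with value
      \<open>0\<close>; but \<open>\<beta> 0\<close> is positive at \<open>xstar\<close>, and
      \<open>\<beta> i\<close> is negative somewhere.\<close>
    have "Gi x \<noteq> 0"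
    proof (cases "i = 0")
      case True
      then show ?thesis using outer[of x Gi Hi] i by auto
    next
      case False
      then have i': "i \<in> {1..m}" using i(1) by auto
      obtain y where y: "\<beta> i y < 0" using Obs_ne[OF i'] by blast
      have "(\<beta> i has_derivative (\<lambda>h. Gi x \<bullet> h)) (at x)"
        using gradient_hessian_onD1[OF i(4), of x] by simp
      from convex_on_above_tangent[OF _ this, of y] have "Gi x \<bullet> (y - x) < 0"
        using y i(2) betai[OF i'] by simp
      then show ?thesis by auto
    qed
    then show ?thesis using i by simp
  qed

  interpret obstacle_potential f0 ?B Gf GB Hf HB xstar lmin lmax ?F
  proof
    show "?F = {x. 0 \<le> ?B x}" by (rule free_space_def)
    show "compact ?F" by fact
    show "interior ?F = {x. 0 < ?B x}" by fact
    show "Ck_on 2 ?F f0" "Ck_on 2 ?F ?B"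
      using Ck_on_subset[OF f0(2) F_X] Ck_on_subset[OF Ck_B] by auto
    show "gradient_hessian_on ?F f0 Gf Hf" by (rule gradient_hessian_on_subset[OF f F_X])
    show "gradient_hessian_on UNIV ?B GB HB" "0 < ?B xstar" "Gf xstar = 0" "0 < lmin" "lmin \<le> lmax"
      by fact+
    show "0 \<le> f0 x" if "x \<in> ?F" for x using f0(1) F_X that by blast
    show "0 < f0 x" if "x \<in> ?F" "x \<noteq> xstar" for x
      using strongly_convex_on_strict_min[OF f0(3) xstar(1), of x] f0(1)[OF p_min(1)] F_X that by fastforce
    show "lmin * (norm (x - xstar))\<^sup>2 \<le> Gf x \<bullet> (x - xstar)" if "0 < ?B x" for x
      by (rule Gf_mono[OF that])
    show "lmin * (norm v)\<^sup>2 \<le> v \<bullet> (Hf x *v v)" "v \<bullet> (Hf x *v v) \<le> lmax * (norm v)\<^sup>2"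
      if "0 < ?B x" for x v using Hf_bounds[OF int_X[OF that]] by auto
    show "GB x \<noteq> 0" if "?B x = 0" for x by (rule regular[OF that])
    show "lmax / lmin * (GB x \<bullet> (x - xstar)) < (norm (x - xstar))\<^sup>2 * (v \<bullet> (HB x *v v))"
      if Bx: "?B x = 0" and v: "norm v = 1" "GB x \<bullet> v = 0" and out: "0 \<le> GB x \<bullet> (x - xstar)" for x v
    proof -
      obtain i Gi Hi c where i: "i \<le> m" "\<beta> i x = 0" "0 < c" "gradient_hessian_on UNIV (\<beta> i) Gi Hi"
        "GB x = c *\<^sub>R Gi x" "\<And>v. Gi x \<bullet> v = 0 \<Longrightarrow> v \<bullet> (HB x *v v) = c * (v \<bullet> (Hi x *v v))"
        using boundary[OF Bx] by blast
      have "i \<noteq> 0"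
      proof
        assume "i = 0"
        then have "Gi x \<bullet> (x - xstar) < 0" using outer i(2,4) by simp
        then show False using out i(3,5) by (simp add: zero_le_mult_iff)
      qed
      then have i': "i \<in> {1..m}" using i(1) by auto
      have xX: "x \<in> X" using Bx F_X by (auto simp: F_iff)
      \<comment> \<open>The curvature condition is stated on the topological frontier, whereas
        \<open>x\<close> is given by \<open>\<beta> i x = 0\<close>; obstacle points accumulating at
        \<open>x\<close> connect the two.\<close>
      have "x \<in> frontier (Obs i)"
      proof -
        have "x \<notin> Obs i" using i(2) betai[OF i'] by simp
        moreover have "x \<in> closure (Obs i)"
        proof (rule ccontr)
          assume x: "x \<notin> closure (Obs i)"
          obtain y where "\<beta> i y < 0" using Obs_ne[OF i'] by blast
          then obtain z where "z \<in> - closure (Obs i)" "\<beta> i z < 0"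
            using sublevel_accumulates[of "\<beta> i" x y "- closure (Obs i)"] betai[OF i'] i(2) x by auto
          then show False using betai[OF i'] closure_subset[of "Obs i"] by blast
        qed
        ultimately show ?thesis using Obs[OF i'] by (simp add: frontier_def interior_open)
      qed
      from condition[OF i' this]
      have cond: "lmax / lmin * ((Gi x \<bullet> (x - xstar)) / (norm (x - xstar))\<^sup>2) < mumin i"
        using gradient_hessian_on_grad[OF i(4), of x] by simp
      have nz: "(norm (x - xstar))\<^sup>2 > 0" using Bx B_p by auto
      have "hessian_on UNIV (\<beta> i) x = Hi x"
        by (rule gradient_hessian_on_hessian[OF i(4)]) simp
      then have "eigenvalues (Hi x) \<subseteq> {mumin i..mumax i}"
        using mu[OF i'] xX by metis
      then have "mumin i * (norm v)\<^sup>2 \<le> v \<bullet> (Hi x *v v)"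
        using gradient_hessian_on_symmetric[OF i(4), of x]
        by (auto intro!: inner_matrix_ge_if_eigenvalues_ge)
      then have "lmax / lmin * ((Gi x \<bullet> (x - xstar)) / (norm (x - xstar))\<^sup>2) < v \<bullet> (Hi x *v v)"
        using cond v(1) by simp
      then have "(norm (x - xstar))\<^sup>2 * (lmax / lmin * ((Gi x \<bullet> (x - xstar)) / (norm (x - xstar))\<^sup>2))
          < (norm (x - xstar))\<^sup>2 * (v \<bullet> (Hi x *v v))"
        using nz by (rule mult_strict_left_mono)
      then have "lmax / lmin * (Gi x \<bullet> (x - xstar)) < (norm (x - xstar))\<^sup>2 * (v \<bullet> (Hi x *v v))"
        using nz by simp
      then have "c * (lmax / lmin * (Gi x \<bullet> (x - xstar))) < c * ((norm (x - xstar))\<^sup>2 * (v \<bullet> (Hi x *v v)))"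
        using i(3) by (rule mult_strict_left_mono)
      moreover have "v \<bullet> (HB x *v v) = c * (v \<bullet> (Hi x *v v))"
        using v(2) i(3,5) by (intro i(6)) simp
      ultimately show ?thesis by (simp add: i(5) mult_ac)
    qed
    show "GB x \<bullet> (x - xstar) < 0" if dim: "CARD('n) = 1" and Bx: "?B x = 0" for x
    proof -
      \<comment> \<open>A connected set in dimension one is an interval, so the segment from
        \<open>x\<close> to \<open>xstar\<close> stays in the free space and the product cannot
        decrease along it at \<open>x\<close>. A zero slope is excluded because nonzero vectors in
        dimension one are never orthogonal.\<close>
      have "convex ?F" using connected_convex_1_gen[of ?F] dim manifold(2) by simp
      have "\<not> GB x \<bullet> (xstar - x) < 0"
      proof
        assume neg: "GB x \<bullet> (xstar - x) < 0"
        have "((\<lambda>s. ?B (x + s *\<^sub>R (xstar - x))) has_real_derivative GB x \<bullet> (xstar - x)) (at 0)"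
          using has_real_derivative_along_line[of ?B "GB x" x 0 "xstar - x"]
            gradient_hessian_onD1[OF B, of x] by simp
        from DERIV_neg_dec_right[OF this neg]
        obtain d where d: "d > 0" "\<And>s. 0 < s \<Longrightarrow> s < d \<Longrightarrow> ?B (x + s *\<^sub>R (xstar - x)) < 0"
          using Bx by auto
        define s where "s = min d 1 / 2"
        have s: "0 < s" "s < d" "s \<le> 1" using d(1) by (auto simp: s_def)
        have "(1 - s) *\<^sub>R x + s *\<^sub>R xstar \<in> ?F"
          using s Bx p_F by (intro convexD_alt[OF \<open>convex ?F\<close>]) (auto simp: F_iff)
        then have "0 \<le> ?B (x + s *\<^sub>R (xstar - x))" by (simp add: F_iff algebra_simps)
        then show False using d(2)[OF s(1,2)] by simp
      qed
      moreover have "GB x \<bullet> (xstar - x) \<noteq> 0"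
        using Bx B_p by (intro inner_nonzero_dim_1[OF dim regular[OF Bx]]) auto
      ultimately show ?thesis by (simp add: inner_diff_right)
    qed
  qed

  have phi_potential: "phi k = potential f0 m \<beta> k" for k
    by (rule ext) (simp add: phi_def potential_def)
  have "grad_on UNIV ?B xstar = GB xstar"
    using gradient_hessian_on_grad[OF B, of xstar] by simp
  then show ?thesis
    using navigation_function_phi unfolding phi_potential by metis
qed

end
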